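(* Let $\mathbb{F}_q$ be a finite field with $q$ elements and let $\mathcal{A}$ be an affine line arrangement in $V=\mathbb{F}_q^2$. If $\chi(\mathcal{A},q-1)=0$, then $\mathcal{A}$ is free.
   Context: An affine line arrangement $\mathcal{A}$ in $V=\mathbb{K}^2$ (here $\mathbb{K}=\mathbb{F}_q$) is a finite set of affine lines in $V$. $L(\mathcal{A})$ is the set of all nonempty intersections of subsets of $\mathcal{A}$ (including $V$, the empty intersection). Define $\mu(V)=1$ and $\mu(X)=-\sum_{Y\in L(\mathcal{A}),\,X\subsetneq Y\subset V}\mu(Y)$; the characteristic polynomial is $\chi(\mathcal{A},t)=\sum_{X\in L(\mathcal{A})}\mu(X)t^{\dim X}$. Freeness: let $S=\mathbb{K}[x,y,z]$. The cone $c\mathcal{A}$ is the central arrangement in $\mathbb{K}^3$ consisting of the plane $z=0$ and the planes $cH=\{\alpha_{cH}=0\}$, $H\in\mathcal{A}$, where $\alpha_{cH}$ is the homogenization by $z$ of a degree one polynomial defining $H$. Let $D(c\mathcal{A})=\{\theta\in\mathrm{Der}\,S\mid \theta(\alpha_{cH})\in S\alpha_{cH}\ (\forall H\in\mathcal{A}),\ \theta(z)\in Sz\}$, where $\mathrm{Der}\,S$ is the module of $\mathbb{K}$-derivations of $S$. $\mathcal{A}$ is free if $D(c\mathcal{A})$ is a free $S$-module (with a homogeneous basis $\theta_E=x\partial_x+y\partial_y+z\partial_z,\theta_1,\theta_2$). *)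

theory Defs
  imports "HOL-Analysis.Analysis" "HOL-Computational_Algebra.Polynomial" "HOL-Library.Function_Algebras"
begin

section \<open>Affine line arrangements in the plane over a finite field\<close>

definition zero_locus :: "'a::field \<Rightarrow> 'a \<Rightarrow> 'a \<Rightarrow> ('a^2) set" where
  "zero_locus a b c = {v. a * v $ 1 + b * v $ 2 + c = 0}"

definition is_line :: "('a::field^2) set \<Rightarrow> bool" where
  "is_line H \<longleftrightarrow> (\<exists>a b c. (a, b) \<noteq> (0, 0) \<and> H = zero_locus a b c)"

definition line_arrangement :: "('a::field^2) set set \<Rightarrow> bool" where
  "line_arrangement \<A> \<longleftrightarrow> finite \<A> \<and> (\<forall>H\<in>\<A>. is_line H)"

text \<open>The empty subset contributes the whole plane, as \<open>\<Inter>{} = UNIV\<close>.\<close>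

definition intersection_poset :: "('a^2) set set \<Rightarrow> ('a^2) set set" where
  "intersection_poset \<A> = {\<Inter>\<B> | \<B>. \<B> \<subseteq> \<A>} - {{}}"

text \<open>Dimension of a nonempty affine subspace, i.e. that of its space of directions.\<close>

definition affine_dim :: "('a::field^2) set \<Rightarrow> nat" where
  "affine_dim X = vec.dim {u - v | u v. u \<in> X \<and> v \<in> X}"

function moebius :: "('a::{field,finite}^2) set set \<Rightarrow> ('a^2) set \<Rightarrow> int" where
  "moebius \<A> X =
     (if X = UNIV then 1 else - (\<Sum>Y\<in>{Y \<in> intersection_poset \<A>. X \<subset> Y}. moebius \<A> Y))"
  by auto
termination
  by (relation "Wellfounded.measure (\<lambda>(\<A>, X). card (- X))") (auto intro!: psubset_card_mono)

declare moebius.simps [simp del]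

definition characteristic_poly :: "('a::{field,finite}^2) set set \<Rightarrow> int poly" where
  "characteristic_poly \<A> = (\<Sum>X\<in>intersection_poset \<A>. monom (moebius \<A> X) (affine_dim X))"


section \<open>Polynomials in three variables and their derivations\<close>

text \<open>\<open>S = K[x,y,z]\<close> is the iterated polynomial ring \<open>K[x][y][z]\<close>; the outermost
  variable is \<open>z\<close>.\<close>

type_synonym 'a poly3 = "'a poly poly poly"

definition Const :: "'a::field \<Rightarrow> 'a poly3" where "Const c = [:[:[:c:]:]:]"
definition X\<^sub>3 :: "'a::field poly3" where "X\<^sub>3 = [:[:[:0, 1:]:]:]"
definition Y\<^sub>3 :: "'a::field poly3" where "Y\<^sub>3 = [:[:0, 1:]:]"
definition Z\<^sub>3 :: "'a::field poly3" where "Z\<^sub>3 = [:0, 1:]"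

definition homogeneous :: "nat \<Rightarrow> 'a::field poly3 \<Rightarrow> bool" where
  "homogeneous d p \<longleftrightarrow> (\<forall>i j k. coeff (coeff (coeff p k) j) i \<noteq> 0 \<longrightarrow> i + j + k = d)"

definition derivation :: "('a::field poly3 \<Rightarrow> 'a poly3) \<Rightarrow> bool" where
  "derivation \<theta> \<longleftrightarrow>
     (\<forall>p q. \<theta> (p + q) = \<theta> p + \<theta> q) \<and>
     (\<forall>c p. \<theta> (Const c * p) = Const c * \<theta> p) \<and>
     (\<forall>p q. \<theta> (p * q) = p * \<theta> q + q * \<theta> p)"

definition homogeneous_derivation :: "nat \<Rightarrow> ('a::field poly3 \<Rightarrow> 'a poly3) \<Rightarrow> bool" where
  "homogeneous_derivation d \<theta> \<longleftrightarrow>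
     derivation \<theta> \<and> homogeneous d (\<theta> X\<^sub>3) \<and> homogeneous d (\<theta> Y\<^sub>3) \<and> homogeneous d (\<theta> Z\<^sub>3)"

text \<open>The partial derivatives with respect to \<open>x\<close>, \<open>y\<close>, \<open>z\<close> are
  \<open>map_poly (map_poly pderiv)\<close>, \<open>map_poly pderiv\<close> and \<open>pderiv\<close>.\<close>

definition euler :: "'a::field poly3 \<Rightarrow> 'a poly3" where
  "euler p = X\<^sub>3 * map_poly (map_poly pderiv) p + Y\<^sub>3 * map_poly pderiv p + Z\<^sub>3 * pderiv p"

definition der_scale ::
    "'a::field poly3 \<Rightarrow> ('a poly3 \<Rightarrow> 'a poly3) \<Rightarrow> ('a poly3 \<Rightarrow> 'a poly3)" where
  "der_scale f \<theta> = (\<lambda>p. f * \<theta> p)"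

text \<open>All self-maps of \<open>S\<close> form an \<open>S\<close>-module, with \<open>Der S\<close> as a submodule.\<close>

global_interpretation der: module "der_scale :: 'a::field poly3 \<Rightarrow> _"
  by unfold_locales (auto simp: der_scale_def fun_eq_iff algebra_simps)


section \<open>Logarithmic derivations of the cone and freeness\<close>

text \<open>The homogenization of \<open>a x + b y + c\<close> by \<open>z\<close>.\<close>

definition cone_form :: "'a::field \<Rightarrow> 'a \<Rightarrow> 'a \<Rightarrow> 'a poly3" where
  "cone_form a b c = Const a * X\<^sub>3 + Const b * Y\<^sub>3 + Const c * Z\<^sub>3"

text \<open>A degree one polynomial defining a line \<open>H\<close> is unique up to a nonzero scalar, so it is
  immaterial that the condition is imposed for every choice of it.\<close>

definition cone_derivations ::
    "('a::field^2) set set \<Rightarrow> ('a poly3 \<Rightarrow> 'a poly3) set" where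
  "cone_derivations \<A> = {\<theta>. derivation \<theta> \<and>
     (\<forall>H\<in>\<A>. \<forall>a b c. (a, b) \<noteq> (0, 0) \<and> H = zero_locus a b c \<longrightarrow>
        cone_form a b c dvd \<theta> (cone_form a b c)) \<and>
     Z\<^sub>3 dvd \<theta> Z\<^sub>3}"

definition free_arrangement :: "('a::field^2) set set \<Rightarrow> bool" where
  "free_arrangement \<A> \<longleftrightarrow> (\<exists>\<theta>\<^sub>1 \<theta>\<^sub>2 d\<^sub>1 d\<^sub>2.
     homogeneous_derivation d\<^sub>1 \<theta>\<^sub>1 \<and> homogeneous_derivation d\<^sub>2 \<theta>\<^sub>2 \<and>
     distinct [euler, \<theta>\<^sub>1, \<theta>\<^sub>2] \<and>
     der.independent {euler, \<theta>\<^sub>1, \<theta>\<^sub>2} \<and>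
     der.span {euler, \<theta>\<^sub>1, \<theta>\<^sub>2} = cone_derivations \<A>)"

end

theory Submission
  imports Defs
begin

text \<open>
  Write \<open>q\<close> for the size of the field, \<open>n\<close> for the number of lines, \<open>f\<close> for the product of the linear
  forms of the lines, and \<open>M\<close> for the set of points of the plane on no line. For plane vector fields
  \<open>\<theta> = (P, Q)\<close> and \<open>\<theta>' = (P', Q')\<close> put \<open>\<theta> \<and> \<theta>' = P Q' - Q P'\<close>. By Saito's criterion the arrangement
  is free as soon as two homogeneous vector fields tangent to all the lines satisfy
  \<open>\<theta> \<and> \<theta>' = e f\<close> with a nonzero constant \<open>e\<close>.

  Over a finite field there is a vector field tangent to every line at once, the Frobenius field
  \<open>\<eta> = (u, v)\<close> with \<open>u = x\<^sup>q - x z\<^bsup>q-1\<^esup>\<close> and \<open>v = y\<^sup>q - y z\<^bsup>q-1\<^esup>\<close>, and the forms vanishing at all points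
  of the affine plane are exactly those of the ideal \<open>(u, v)\<close> (\<open>vanishing_in_frob_ideal\<close>). So each such
  form \<open>g\<close> of degree \<open>N\<close> is \<open>\<theta> \<and> \<eta>\<close> for a field \<open>\<theta>\<close> of degree \<open>N - q\<close>. If moreover \<open>f\<close> divides \<open>g\<close>,
  then \<open>\<theta>\<close> is parallel to \<open>\<eta>\<close> along every line of the arrangement, hence tangent to it
  (\<open>tangent_field_of_vanishing_multiple\<close>). This manufactures logarithmic fields from multiples of \<open>f\<close>
  that vanish on the whole plane. If \<open>M\<close> is empty, \<open>f\<close> itself is such a multiple, and
  \<open>\<theta>\<close>, \<open>\<eta>\<close> and the Euler derivation form a basis.

  In general, Moebius inversion gives that \<open>\<chi>(q)\<close> is the number of points in \<open>M\<close>, and comparing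
  coefficients gives \<open>\<chi>(q) - \<chi>(q - 1) = 2 q - 1 - n\<close>. Hence \<open>\<chi>(q - 1) = 0\<close> means that \<open>M\<close> has exactly
  \<open>2 q - 1 - n\<close> points. A form nonzero at exactly one point of the plane has degree at least \<open>2 (q - 1)\<close>,
  because values of forms of lower degree sum to zero. This forces \<open>M\<close> to be collinear
  (\<open>uncovered_points_collinear\<close>): otherwise \<open>f\<close> times a line through two points of \<open>M\<close> and further lines
  through all but one of the others would violate the bound. Let \<open>\<gamma>\<close> be the form of a line containing
  \<open>M\<close>, and \<open>h\<close> the product of the forms of parallel lines, transversal to it, through the points of \<open>M\<close>.
  Both \<open>f h\<close> and \<open>f \<gamma>\<close> vanish on the whole plane, so they give tangent fields \<open>\<theta>\<close> and \<open>\<theta>'\<close>, of degrees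
  \<open>q - 1\<close> and \<open>n + 1 - q\<close>. These degrees add up to \<open>n\<close>, so \<open>\<theta> \<and> \<theta>'\<close>, being divisible by \<open>f\<close>, is a
  constant multiple of \<open>f\<close>. If it were zero, then \<open>h \<theta>' = \<gamma> \<theta>\<close>, so \<open>\<theta>'\<close> would be divisible by \<open>\<gamma>\<close>, and
  \<open>f = (\<theta>' / \<gamma>) \<and> \<eta>\<close> would vanish on \<open>M\<close> (\<open>free_if_collinear_complement\<close>).
\<close>


section \<open>Polynomials in three variables\<close>

abbreviation coeff3 :: "'a::field poly3 \<Rightarrow> nat \<Rightarrow> nat \<Rightarrow> nat \<Rightarrow> 'a" where
  "coeff3 p i j k \<equiv> coeff (coeff (coeff p k) j) i"

definition monom3 :: "'a::field \<Rightarrow> nat \<Rightarrow> nat \<Rightarrow> nat \<Rightarrow> 'a poly3" where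
  "monom3 c i j k = monom (monom (monom c i) j) k"

lemma coeff3_monom3:
  "coeff3 (monom3 c i j k) i' j' k' = (if i' = i \<and> j' = j \<and> k' = k then c else 0)"
  by (auto simp: monom3_def)

lemma poly3_eqI:
  assumes "\<And>i j k. coeff3 p i j k = coeff3 q i j k"
  shows "p = q"
  using assms by (intro poly_eqI)

lemma monom3_altdef: "monom3 c i j k = Const c * X\<^sub>3 ^ i * Y\<^sub>3 ^ j * Z\<^sub>3 ^ k"
proof -
  have "X\<^sub>3 ^ i = ([:[:monom 1 i:]:] :: 'a poly3)"
  proof (induction i)
    case 0
    show ?case by (simp add: monom_0 one_pCons)
  qed (simp add: X\<^sub>3_def monom_Suc)
  moreover have "Y\<^sub>3 ^ j = ([:monom 1 j:] :: 'a poly3)"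
  proof (induction j)
    case 0
    show ?case by (simp add: monom_0 one_pCons)
  qed (simp add: Y\<^sub>3_def monom_Suc)
  moreover have "Z\<^sub>3 ^ k = (monom 1 k :: 'a poly3)"
    by (induction k) (simp_all add: Z\<^sub>3_def monom_Suc)
  ultimately show ?thesis
    by (simp add: monom3_def Const_def smult_monom)
qed

lemma poly3_as_sum_of_monoms:
  "p = (\<Sum>k\<le>degree p. \<Sum>j\<le>degree (coeff p k). \<Sum>i\<le>degree (coeff (coeff p k) j).
          monom3 (coeff3 p i j k) i j k)"
proof -
  have monom_sum: "monom (sum f A) n = (\<Sum>x\<in>A. monom (f x) n)"
    for f :: "nat \<Rightarrow> 'b::comm_monoid_add" and A n
    by (induction A rule: infinite_finite_induct) (auto simp: add_monom[symmetric])
  have "(\<Sum>k\<le>degree p. \<Sum>j\<le>degree (coeff p k). \<Sum>i\<le>degree (coeff (coeff p k) j).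
          monom3 (coeff3 p i j k) i j k) =
        (\<Sum>k\<le>degree p. monom (\<Sum>j\<le>degree (coeff p k). monom (\<Sum>i\<le>degree (coeff (coeff p k) j).
          monom (coeff3 p i j k) i) j) k)"
    by (simp add: monom3_def monom_sum)
  then show ?thesis
    by (simp add: poly_as_sum_of_monoms)
qed

lemma homogeneous_induct [consumes 1, case_names zero add monom]:
  assumes "homogeneous d p"
    and "P 0" and "\<And>p q. P p \<Longrightarrow> P q \<Longrightarrow> P (p + q)"
    and "\<And>c i j k. i + j + k = d \<Longrightarrow> P (monom3 c i j k)"
  shows "P p"
proof -
  have sumI: "P (\<Sum>x\<in>A. f x)" if "\<And>x. x \<in> A \<Longrightarrow> P (f x)" for A :: "nat set" and f
    using that assms(2,3) by (induction A rule: infinite_finite_induct) auto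
  have "P (monom3 (coeff3 p i j k) i j k)" for i j k
  proof (cases "coeff3 p i j k = 0")
    case True
    then show ?thesis using assms(2) by (simp add: monom3_def)
  next
    case False
    then show ?thesis using assms(1,4) by (auto simp: homogeneous_def)
  qed
  then show ?thesis
    by (subst poly3_as_sum_of_monoms) (intro sumI)
qed

lemma monom3_induct [case_names zero add monom]:
  assumes "P 0" and "\<And>p q. P p \<Longrightarrow> P q \<Longrightarrow> P (p + q)"
    and "\<And>c i j k. P (monom3 c i j k)"
  shows "P p"
proof -
  have sumI: "P (\<Sum>x\<in>A. f x)" if "\<And>x. x \<in> A \<Longrightarrow> P (f x)" for A :: "nat set" and f
    using that assms(1,2) by (induction A rule: infinite_finite_induct) auto
  show ?thesis
    by (subst poly3_as_sum_of_monoms) (intro sumI assms)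
qed

lemma poly3_induct [case_names Const X Y Z add mult]:
  assumes "\<And>c. P (Const c)" "P X\<^sub>3" "P Y\<^sub>3" "P Z\<^sub>3"
    and "\<And>p q. P p \<Longrightarrow> P q \<Longrightarrow> P (p + q)" and mult: "\<And>p q. P p \<Longrightarrow> P q \<Longrightarrow> P (p * q)"
  shows "P p"
proof (induction p rule: monom3_induct)
  case zero
  then show ?case using assms(1)[of 0] by (simp add: Const_def)
next
  case (monom c i j k)
  have "P 1" using assms(1)[of 1] by (simp add: Const_def one_pCons)
  then have power: "P (q ^ n)" if "P q" for q n
    using that by (induction n) (auto intro: mult)
  show ?case
    unfolding monom3_altdef by (intro mult power assms)
qed (use assms in auto)


subsection \<open>Substitution\<close>

text \<open>
  Homomorphisms are a predicate on functions because those needed here, such as substitutions, are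
  built from arbitrary parameters.
\<close>

definition unital_hom :: "('a::comm_ring_1 \<Rightarrow> 'b::comm_ring_1) \<Rightarrow> bool" where
  "unital_hom f \<longleftrightarrow> f 0 = 0 \<and> f 1 = 1 \<and>
     (\<forall>x y. f (x + y) = f x + f y) \<and> (\<forall>x y. f (x * y) = f x * f y)"

lemma unital_homD:
  assumes "unital_hom f"
  shows "f 0 = 0" "f 1 = 1" "f (x + y) = f x + f y" "f (x * y) = f x * f y"
    "f (x ^ n) = f x ^ n" "f (- x) = - f x" "f (x - y) = f x - f y"
proof -
  show *: "f 0 = 0" "f 1 = 1" "f (x + y) = f x + f y" "f (x * y) = f x * f y" for x y
    using assms by (auto simp: unital_hom_def)
  show "f (x ^ n) = f x ^ n"
    by (induction n) (auto simp: *)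
  show **: "f (- x) = - f x" for x
    using *(3)[of x "- x"] *(1) by (simp add: eq_neg_iff_add_eq_0 add.commute)
  show "f (x - y) = f x - f y"
    using *(3)[of x "- y"] ** by simp
qed

lemma unital_hom_poly_map_poly:
  assumes "unital_hom f"
  shows "unital_hom (\<lambda>p. poly (map_poly f p) a)"
proof -
  note hom = unital_homD[OF assms]
  have add: "map_poly f (p + q) = map_poly f p + map_poly f q" for p q
    by (rule poly_eqI) (simp add: coeff_map_poly hom)
  have smult: "map_poly f (smult c p) = smult (f c) (map_poly f p)" for c p
    by (rule poly_eqI) (simp add: coeff_map_poly hom)
  have mult: "map_poly f (p * q) = map_poly f p * map_poly f q" for p q
    by (induction p) (simp_all add: add smult hom map_poly_pCons)
  show ?thesis
    by (auto simp: unital_hom_def add mult hom)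
qed

definition subst3 :: "('a::field \<Rightarrow> 'b::comm_ring_1) \<Rightarrow> 'b \<Rightarrow> 'b \<Rightarrow> 'b \<Rightarrow> 'a poly3 \<Rightarrow> 'b" where
  "subst3 f a b c p =
     poly (map_poly (\<lambda>q. poly (map_poly (\<lambda>r. poly (map_poly f r) a) q) b) p) c"

lemma unital_hom_subst3: "unital_hom f \<Longrightarrow> unital_hom (subst3 f a b c)"
  unfolding subst3_def[abs_def] by (intro unital_hom_poly_map_poly)

lemma subst3_simps:
  assumes "unital_hom f"
  shows "subst3 f a b c (Const e) = f e" "subst3 f a b c X\<^sub>3 = a"
    "subst3 f a b c Y\<^sub>3 = b" "subst3 f a b c Z\<^sub>3 = c"
  by (simp_all add: subst3_def Const_def X\<^sub>3_def Y\<^sub>3_def Z\<^sub>3_def unital_homD[OF assms] map_poly_pCons)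

lemma unital_hom_Const: "unital_hom Const"
  by (simp add: unital_hom_def Const_def one_pCons)

lemma Const_simps:
  "Const 0 = 0" "Const 1 = 1" "Const (a + b) = Const a + Const b"
  "Const (a * b) = Const a * Const b" "Const (a ^ n) = Const a ^ n"
  "Const (- a) = - Const a" "Const (a - b) = Const a - Const b"
  by (fact unital_homD[OF unital_hom_Const])+

definition value_at :: "'a::field \<Rightarrow> 'a \<Rightarrow> 'a \<Rightarrow> 'a poly3 \<Rightarrow> 'a" where
  "value_at a b c p = poly (poly (poly p [:[:c:]:]) [:b:]) a"

lemma value_at_simps [simp]:
  "value_at a b c 0 = 0" "value_at a b c 1 = 1"
  "value_at a b c (p + q) = value_at a b c p + value_at a b c q"
  "value_at a b c (p - q) = value_at a b c p - value_at a b c q"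
  "value_at a b c (- p) = - value_at a b c p"
  "value_at a b c (p * q) = value_at a b c p * value_at a b c q"
  "value_at a b c (p ^ n) = value_at a b c p ^ n"
  "value_at a b c (Const e) = e" "value_at a b c X\<^sub>3 = a" "value_at a b c Y\<^sub>3 = b"
  "value_at a b c Z\<^sub>3 = c"
  by (simp_all add: value_at_def Const_def X\<^sub>3_def Y\<^sub>3_def Z\<^sub>3_def poly_power)

lemma value_at_prod [simp]: "value_at a b c (prod f A) = (\<Prod>x\<in>A. value_at a b c (f x))"
  by (induction A rule: infinite_finite_induct) auto


subsection \<open>Homogeneity\<close>

text \<open>
  The substitution of \<open>t x, t y, t z\<close> for \<open>x, y, z\<close>. It turns homogeneity into an equation between ring
  homomorphisms, so that it passes to products and to quotients without any work on coefficients.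
\<close>

definition dilate :: "'a::field poly3 \<Rightarrow> 'a poly3 poly" where
  "dilate = subst3 (\<lambda>c. [:Const c:]) (monom X\<^sub>3 1) (monom Y\<^sub>3 1) (monom Z\<^sub>3 1)"

lemma unital_hom_pConst: "unital_hom (\<lambda>c::'a::field. [:Const c:])"
  by (simp add: unital_hom_def Const_simps one_pCons)

lemma unital_hom_dilate: "unital_hom dilate"
  unfolding dilate_def by (intro unital_hom_subst3 unital_hom_pConst)

lemmas dilate_hom = unital_homD[OF unital_hom_dilate]

lemma dilate_monom3: "dilate (monom3 c i j k) = monom (monom3 c i j k) (i + j + k)"
proof -
  have [simp]: "dilate (Const c) = [:Const c:]" for c :: 'a
    by (simp add: dilate_def subst3_simps unital_hom_pConst)
  have [simp]: "dilate X\<^sub>3 = monom (X\<^sub>3::'a poly3) 1" "dilate Y\<^sub>3 = monom (Y\<^sub>3::'a poly3) 1"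
    "dilate Z\<^sub>3 = monom (Z\<^sub>3::'a poly3) 1"
    by (simp_all add: dilate_def subst3_simps unital_hom_pConst)
  show ?thesis
    by (simp add: monom3_altdef dilate_hom monom_power mult_monom smult_monom add_ac mult_ac)
qed

lemma coeff_dilate: "coeff3 (coeff (dilate p) d) i j k = (if i + j + k = d then coeff3 p i j k else 0)"
  by (induction p rule: monom3_induct) (auto simp: dilate_hom dilate_monom3 coeff3_monom3)

lemma homogeneous_iff_dilate: "homogeneous d p \<longleftrightarrow> dilate p = monom p d"
proof
  assume *: "homogeneous d p"
  show "dilate p = monom p d"
    by (intro poly_eqI poly3_eqI) (use * in \<open>auto simp: coeff_dilate homogeneous_def\<close>)
next
  assume *: "dilate p = monom p d"
  show "homogeneous d p"
    unfolding homogeneous_def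
  proof (intro allI impI)
    fix i j k assume "coeff3 p i j k \<noteq> 0"
    moreover have "coeff3 (coeff (dilate p) d) i j k = coeff3 p i j k"
      by (simp add: *)
    ultimately show "i + j + k = d"
      by (metis coeff_dilate)
  qed
qed

lemma homogeneous_0 [simp]: "homogeneous d 0"
  by (simp add: homogeneous_def)

lemma homogeneous_add: "homogeneous d p \<Longrightarrow> homogeneous d q \<Longrightarrow> homogeneous d (p + q)"
  by (simp add: homogeneous_iff_dilate dilate_hom add_monom)

lemma homogeneous_diff: "homogeneous d p \<Longrightarrow> homogeneous d q \<Longrightarrow> homogeneous d (p - q)"
  by (simp add: homogeneous_iff_dilate dilate_hom diff_monom)

lemma homogeneous_minus: "homogeneous d p \<Longrightarrow> homogeneous d (- p)"
  by (simp add: homogeneous_iff_dilate dilate_hom minus_monom)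

lemma homogeneous_mult: "homogeneous d p \<Longrightarrow> homogeneous e q \<Longrightarrow> homogeneous (d + e) (p * q)"
  by (simp add: homogeneous_iff_dilate dilate_hom mult_monom)

lemma homogeneous_power: "homogeneous d p \<Longrightarrow> homogeneous (d * n) (p ^ n)"
  by (simp add: homogeneous_iff_dilate dilate_hom monom_power mult.commute)

lemma homogeneous_monom3: "homogeneous (i + j + k) (monom3 c i j k)"
  by (simp add: homogeneous_iff_dilate dilate_monom3)

lemma homogeneous_Const: "homogeneous 0 (Const c)"
  using homogeneous_monom3[of 0 0 0 c] by (simp add: monom3_altdef)

lemma homogeneous_XYZ: "homogeneous 1 X\<^sub>3" "homogeneous 1 Y\<^sub>3" "homogeneous 1 Z\<^sub>3"
  using homogeneous_monom3[of 1 0 0 1] homogeneous_monom3[of 0 1 0 1] homogeneous_monom3[of 0 0 1 1]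
  by (simp_all add: monom3_altdef Const_simps)

lemma homogeneous_prod:
  assumes "finite A" "\<And>x. x \<in> A \<Longrightarrow> homogeneous 1 (f x)"
  shows "homogeneous (card A) (prod f A)"
  using assms
proof (induction A)
  case empty
  then show ?case using homogeneous_Const[of 1] by (simp add: Const_simps)
next
  case (insert x A)
  then show ?case using homogeneous_mult[of 1 "f x" "card A" "prod f A"] by simp
qed

text \<open>
  Cancelling \<open>f\<close> from \<open>dilate (f e) = t\<^sup>d f e\<close> leaves \<open>dilate e = e\<close>.
\<close>

lemma homogeneous_quotient_same_degree:
  assumes "homogeneous d f" "homogeneous d (f * e)" "f \<noteq> 0"
  obtains c where "e = Const c"
proof -
  have "monom f d * dilate e = monom f d * [:e:]"
    using assms(1,2) by (simp add: homogeneous_iff_dilate dilate_hom smult_monom mult.commute)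
  moreover have "monom f d \<noteq> 0"
    using assms(3) by simp
  ultimately have "dilate e = monom e 0"
    unfolding monom_0 by (rule mult_left_cancel[THEN iffD1, rotated])
  then have hom: "homogeneous 0 e"
    by (simp add: homogeneous_iff_dilate)
  have "e = Const (coeff3 e 0 0 0)"
    by (rule poly3_eqI) (use hom in \<open>auto simp: homogeneous_def Const_def coeff_pCons split: nat.splits\<close>)
  then show ?thesis using that by blast
qed


section \<open>Polynomial functions on the affine plane over a finite field\<close>

lemma card_field_ge_2: "CARD('a::{field,finite}) \<ge> 2"
proof -
  have "card {0, 1::'a} \<le> CARD('a)"
    by (intro card_mono) auto
  then show ?thesis by simp
qed

lemma field_power_card_eq_same: "x ^ CARD('a) = x" for x :: "'a::{field,finite}"
proof (cases "x = 0")
  case False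
  let ?U = "UNIV - {0::'a}"
  have "(\<Prod>y\<in>?U. y) = (\<Prod>y\<in>?U. x * y)"
    by (rule prod.reindex_bij_witness[of _ "\<lambda>y. x * y" "\<lambda>y. y / x"]) (use False in auto)
  also have "\<dots> = x ^ (CARD('a) - 1) * (\<Prod>y\<in>?U. y)"
    by (simp add: prod.distrib)
  finally have "x ^ (CARD('a) - 1) = 1"
    by simp
  then have "x ^ Suc (CARD('a) - 1) = x"
    by (simp only: power_Suc mult_1_right)
  moreover have "Suc (CARD('a) - 1) = CARD('a)"
    using card_field_ge_2[where 'a = 'a] by simp
  ultimately show ?thesis
    by simp
qed (use card_field_ge_2[where 'a = 'a] in simp)

lemma poly_eq_0_if_many_roots:
  fixes p :: "'b::idom poly"
  assumes "finite S" "\<And>x. x \<in> S \<Longrightarrow> poly p x = 0" "\<And>i. i \<ge> card S \<Longrightarrow> coeff p i = 0"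
  shows "p = 0"
proof (rule ccontr)
  assume "p \<noteq> 0"
  then have "degree p < card S"
    using assms(3)[of "degree p"] by (cases "card S \<le> degree p") auto
  moreover have "card S \<le> card {x. poly p x = 0}"
    using assms(1,2) \<open>p \<noteq> 0\<close> by (intro card_mono poly_roots_finite) auto
  ultimately show False
    using card_poly_roots_bound[OF \<open>p \<noteq> 0\<close>] by simp
qed

text \<open>
  A polynomial in one variable of degree below \<open>q\<close> with \<open>q\<close> roots is zero; this is applied to \<open>x\<close> and
  then to \<open>y\<close>. Setting \<open>z = 1\<close> loses nothing, because homogeneity recovers the exponent of \<open>z\<close>.
\<close>

lemma reduced_homogeneous_eq_0:
  fixes r :: "'a::{field,finite} poly3"
  assumes hom: "homogeneous N r"
    and red: "\<And>i j k. coeff3 r i j k \<noteq> 0 \<Longrightarrow> i < CARD('a) \<and> j < CARD('a)"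
    and van: "\<And>a b. value_at a b 1 r = 0"
  shows "r = 0"
proof -
  define w where "w = poly r 1"
  have coeff_w: "coeff (coeff w j) i = (\<Sum>k\<le>degree r. coeff3 r i j k)" for i j
    by (simp add: w_def poly_altdef coeff_sum)
  have "poly w [:b:] = 0" for b
  proof (rule poly_eq_0_if_many_roots[of UNIV])
    show "poly (poly w [:b:]) a = 0" for a
      using van[of a b] by (simp add: value_at_def w_def one_pCons)
    fix i assume "i \<ge> CARD('a)"
    then have "coeff3 r i j k = 0" for j k
      using red[of k j i] by (cases "coeff3 r i j k = 0") auto
    then have "coeff (coeff w j) i = 0" for j
      by (simp add: coeff_w)
    moreover have "poly w [:b:] = (\<Sum>j\<le>degree w. smult (b ^ j) (coeff w j))"
      by (simp add: poly_altdef poly_const_pow mult.commute)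
    ultimately show "coeff (poly w [:b:]) i = 0"
      by (simp add: coeff_sum)
  qed simp
  moreover have "card (range (\<lambda>b::'a. [:b:])) = CARD('a)"
    by (rule card_image) (auto simp: inj_on_def)
  moreover have "coeff w j = 0" if "j \<ge> CARD('a)" for j
  proof (rule poly_eqI)
    fix i
    have "coeff3 r i j k = 0" for k
      using red[of k j i] that by (cases "coeff3 r i j k = 0") auto
    then show "coeff (coeff w j) i = coeff 0 i"
      by (simp add: coeff_w)
  qed
  ultimately have "w = 0"
    by (intro poly_eq_0_if_many_roots[of "range (\<lambda>b. [:b:])"]) auto
  show "r = 0"
  proof (rule poly3_eqI)
    fix i j k
    show "coeff3 r i j k = coeff3 0 i j k"
    proof (rule ccontr)
      assume *: "coeff3 r i j k \<noteq> coeff3 0 i j k"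
      then have "k \<le> degree r"
        by (metis coeff_0 le_degree)
      moreover have "coeff3 r i j k' = 0" if "k' \<noteq> k" for k'
        using hom * that unfolding homogeneous_def by (metis add_left_cancel coeff_0)
      \<comment> \<open>Homogeneity leaves a single exponent of \<open>z\<close> for given \<open>i\<close> and \<open>j\<close>, so nothing cancels at \<open>z = 1\<close>.\<close>
      ultimately have "coeff (coeff w j) i = coeff3 r i j k"
        unfolding coeff_w by (subst sum.remove[of _ k]) auto
      with * \<open>w = 0\<close> show False by simp
    qed
  qed
qed

text \<open>
  The homogenization of \<open>p\<^sup>q - p\<close> for a linear form \<open>p\<close>. It vanishes at every point with \<open>z = 1\<close>.
\<close>

definition frob :: "'a::{field,finite} poly3 \<Rightarrow> 'a poly3" where
  "frob p = p ^ CARD('a) - p * Z\<^sub>3 ^ (CARD('a) - 1)"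

lemma value_at_frob: "value_at a b 1 (frob p) = 0"
  by (simp add: frob_def field_power_card_eq_same)

lemma homogeneous_frob:
  assumes "homogeneous 1 p"
  shows "homogeneous (CARD('a)) (frob p :: 'a::{field,finite} poly3)"
proof -
  have "homogeneous (1 + 1 * (CARD('a) - 1)) (p * Z\<^sub>3 ^ (CARD('a) - 1))"
    by (intro homogeneous_mult homogeneous_power assms homogeneous_XYZ)
  moreover have "homogeneous (1 * CARD('a)) (p ^ CARD('a))"
    by (intro homogeneous_power assms)
  ultimately show ?thesis
    using card_field_ge_2[where 'a = 'a] by (simp add: frob_def homogeneous_diff)
qed

text \<open>
  Division with remainder by \<open>frob x\<close> and \<open>frob y\<close> in degree \<open>N\<close>. For \<open>N < q\<close> the degree \<open>N - q\<close> of the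
  quotients is \<open>0\<close> by truncation.
\<close>

definition frob_reducible :: "nat \<Rightarrow> 'a::{field,finite} poly3 \<Rightarrow> bool" where
  "frob_reducible N g \<longleftrightarrow> (\<exists>A B r. homogeneous (N - CARD('a)) A \<and> homogeneous (N - CARD('a)) B \<and>
     homogeneous N r \<and> (\<forall>i j k. coeff3 r i j k \<noteq> 0 \<longrightarrow> i < CARD('a) \<and> j < CARD('a)) \<and>
     g = frob X\<^sub>3 * A + frob Y\<^sub>3 * B + r)"

lemma frob_reducible_add:
  fixes p q :: "'a::{field,finite} poly3"
  assumes "frob_reducible N p" "frob_reducible N q"
  shows "frob_reducible N (p + q)"
proof -
  let ?red = "\<lambda>r :: 'a poly3. \<forall>i j k. coeff3 r i j k \<noteq> 0 \<longrightarrow> i < CARD('a) \<and> j < CARD('a)"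
  obtain A B r where p: "homogeneous (N - CARD('a)) A" "homogeneous (N - CARD('a)) B"
      "homogeneous N r" "?red r" "p = frob X\<^sub>3 * A + frob Y\<^sub>3 * B + r"
    using assms(1) unfolding frob_reducible_def by blast
  obtain A' B' r' where q: "homogeneous (N - CARD('a)) A'" "homogeneous (N - CARD('a)) B'"
      "homogeneous N r'" "?red r'" "q = frob X\<^sub>3 * A' + frob Y\<^sub>3 * B' + r'"
    using assms(2) unfolding frob_reducible_def by blast
  have red: "?red (r + r')"
  proof (intro allI impI)
    fix i j k assume "coeff3 (r + r') i j k \<noteq> 0"
    then have "coeff3 r i j k \<noteq> 0 \<or> coeff3 r' i j k \<noteq> 0"
      by auto
    then show "i < CARD('a) \<and> j < CARD('a)"
      using p(4) q(4) by blast
  qed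
  have "p + q = frob X\<^sub>3 * (A + A') + frob Y\<^sub>3 * (B + B') + (r + r')"
    unfolding p(5) q(5) by (simp add: algebra_simps)
  with p q red show ?thesis
    unfolding frob_reducible_def
    by (intro exI[of _ "A + A'"] exI[of _ "B + B'"] exI[of _ "r + r'"] conjI homogeneous_add)
qed

lemma frob_mult_monom3:
  fixes c :: "'a::{field,finite}"
  shows "frob X\<^sub>3 * monom3 c i j k =
      monom3 c (i + CARD('a)) j k - monom3 c (i + 1) j (k + (CARD('a) - 1))"
    and "frob Y\<^sub>3 * monom3 c i j k =
      monom3 c i (j + CARD('a)) k - monom3 c i (j + 1) (k + (CARD('a) - 1))"
  unfolding frob_def monom3_altdef power_add power_one_right by (simp_all only: algebra_simps)

text \<open>
  Subtracting a multiple of \<open>frob x\<close> replaces \<open>x\<^sup>q\<close> by \<open>x z\<^bsup>q-1\<^esup>\<close>, which moves degree from \<open>x\<close> to \<open>z\<close>, so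
  the joint degree in \<open>x\<close> and \<open>y\<close> drops.
\<close>

lemma frob_reducible_monom3:
  fixes c :: "'a::{field,finite}"
  assumes "i + j + k = N"
  shows "frob_reducible N (monom3 c i j k)"
  using assms
proof (induction "i + j" arbitrary: i j k rule: less_induct)
  case less
  let ?q = "CARD('a)"
  have q: "?q \<ge> 2" by (rule card_field_ge_2)
  have mult: "frob_reducible N (frob X\<^sub>3 * A)" "frob_reducible N (frob Y\<^sub>3 * A)"
    if "homogeneous (N - ?q) A" for A :: "'a poly3"
    unfolding frob_reducible_def
    by (rule exI[of _ A], rule exI[of _ 0], rule exI[of _ 0], use that in simp,
        rule exI[of _ 0], rule exI[of _ A], rule exI[of _ 0], use that in simp)
  consider "i < ?q" "j < ?q" | i' where "i = i' + ?q" | j' where "j = j' + ?q"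
    by (metis le_Suc_ex add.commute not_le)
  then show ?case
  proof cases
    case 1
    then show ?thesis
      unfolding frob_reducible_def using homogeneous_monom3[of i j k c] less.prems
      by (intro exI[of _ 0] exI[of _ "monom3 c i j k"]) (auto simp: coeff3_monom3 split: if_splits)
  next
    case (2 i')
    have "homogeneous (N - ?q) (monom3 c i' j k)"
    proof -
      have "N - ?q = i' + j + k"
        using less.prems 2 by simp
      then show ?thesis
        using homogeneous_monom3[of i' j k c] by simp
    qed
    moreover have "frob_reducible N (monom3 c (i' + 1) j (k + (?q - 1)))"
      using less.prems 2 q by (intro less.hyps) auto
    moreover have "monom3 c i j k = frob X\<^sub>3 * monom3 c i' j k + monom3 c (i' + 1) j (k + (?q - 1))"
      unfolding frob_mult_monom3 2 by simp
    ultimately show ?thesis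
      by (metis frob_reducible_add mult)
  next
    case (3 j')
    have "homogeneous (N - ?q) (monom3 c i j' k)"
    proof -
      have "N - ?q = i + j' + k"
        using less.prems 3 by simp
      then show ?thesis
        using homogeneous_monom3[of i j' k c] by simp
    qed
    moreover have "frob_reducible N (monom3 c i (j' + 1) (k + (?q - 1)))"
      using less.prems 3 q by (intro less.hyps) auto
    moreover have "monom3 c i j k = frob Y\<^sub>3 * monom3 c i j' k + monom3 c i (j' + 1) (k + (?q - 1))"
      unfolding frob_mult_monom3 3 by simp
    ultimately show ?thesis
      by (metis frob_reducible_add mult)
  qed
qed

text \<open>
  The remainder of the division by \<open>frob x\<close> and \<open>frob y\<close> still vanishes on the plane, so it is zero.
\<close>

theorem vanishing_in_frob_ideal:
  fixes g :: "'a::{field,finite} poly3"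
  assumes "homogeneous N g" "\<And>a b. value_at a b 1 g = 0"
  obtains A B where "homogeneous (N - CARD('a)) A" "homogeneous (N - CARD('a)) B"
    "g = frob X\<^sub>3 * A + frob Y\<^sub>3 * B"
proof -
  have "frob_reducible N g"
    using assms(1)
  proof (induction rule: homogeneous_induct)
    case zero
    then show ?case
      unfolding frob_reducible_def by (intro exI[of _ 0]) auto
  qed (auto intro: frob_reducible_add frob_reducible_monom3)
  then obtain A B r where *: "homogeneous (N - CARD('a)) A" "homogeneous (N - CARD('a)) B"
      "homogeneous N r" "\<And>i j k. coeff3 r i j k \<noteq> 0 \<Longrightarrow> i < CARD('a) \<and> j < CARD('a)"
      "g = frob X\<^sub>3 * A + frob Y\<^sub>3 * B + r"
    unfolding frob_reducible_def by blast
  have "r = 0"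
  proof (rule reduced_homogeneous_eq_0[OF *(3,4)])
    show "value_at a b 1 r = 0" for a b
      using assms(2)[of a b] by (simp add: *(5) value_at_frob)
  qed
  then show ?thesis
    using * that by simp
qed

text \<open>
  Multiplying the summation variable by \<open>c \<noteq> 0\<close> multiplies the sum by \<open>c\<^sup>i\<close>, and some \<open>c\<close> has \<open>c\<^sup>i \<noteq> 1\<close>
  since \<open>t\<^sup>i - 1\<close> has fewer than \<open>q - 1\<close> roots.
\<close>

lemma power_sum_eq_0:
  assumes "i < CARD('a::{field,finite}) - 1"
  shows "(\<Sum>t\<in>(UNIV::'a set). t ^ i) = 0"
proof (cases "i = 0")
  case True
  have "(\<Sum>t\<in>(UNIV::'a set). t) = (\<Sum>t\<in>UNIV. t + 1)"
    by (rule sum.reindex_bij_witness[of _ "\<lambda>t. t + 1" "\<lambda>t. t - 1"]) auto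
  then show ?thesis
    using True by (simp add: sum.distrib)
next
  case False
  have "\<exists>c::'a. c \<noteq> 0 \<and> c ^ i \<noteq> 1"
  proof (rule ccontr)
    assume "\<not> (\<exists>c::'a. c \<noteq> 0 \<and> c ^ i \<noteq> 1)"
    moreover have "card (UNIV - {0::'a}) = CARD('a) - 1"
      by simp
    ultimately have "monom 1 i - 1 = (0 :: 'a poly)"
      using assms by (intro poly_eq_0_if_many_roots[of "UNIV - {0}"]) (auto simp: poly_monom)
    then have "coeff (monom 1 i - 1 :: 'a poly) i = 0"
      by simp
    with False show False by simp
  qed
  then obtain c :: 'a where c: "c \<noteq> 0" "c ^ i \<noteq> 1" by blast
  have "(\<Sum>t\<in>(UNIV::'a set). t ^ i) = (\<Sum>t\<in>UNIV. (c * t) ^ i)"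
    by (rule sum.reindex_bij_witness[of _ "\<lambda>t. c * t" "\<lambda>t. t / c"]) (use c in auto)
  also have "\<dots> = c ^ i * (\<Sum>t\<in>UNIV. t ^ i)"
    by (simp add: power_mult_distrib sum_distrib_left)
  finally show ?thesis
    using c(2) by simp
qed

text \<open>
  In a monomial of degree less than \<open>2 (q - 1)\<close> one of \<open>x\<close>, \<open>y\<close> has exponent less than \<open>q - 1\<close>, so its
  sum factors through a vanishing power sum.
\<close>

lemma sum_values_eq_0:
  fixes g :: "'a::{field,finite} poly3"
  assumes "homogeneous N g" "N < 2 * (CARD('a) - 1)"
  shows "(\<Sum>a\<in>UNIV. \<Sum>b\<in>UNIV. value_at a b 1 g) = 0"
  using assms(1)
proof (induction rule: homogeneous_induct)
  case (add p q)
  then show ?case by (simp add: sum.distrib)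
next
  case (monom c i j k)
  have "(\<Sum>a\<in>UNIV. \<Sum>b\<in>UNIV. value_at a b 1 (monom3 c i j k)) =
      c * ((\<Sum>a\<in>UNIV. a ^ i) * (\<Sum>b\<in>UNIV. b ^ j))"
    by (simp only: sum_product) (simp add: monom3_altdef sum_distrib_left mult.assoc)
  moreover have "i < CARD('a) - 1 \<or> j < CARD('a) - 1"
    using monom assms(2) by linarith
  ultimately show ?case
    using power_sum_eq_0[of i, where 'a = 'a] power_sum_eq_0[of j, where 'a = 'a] by auto
qed simp


section \<open>The linear forms of an arrangement\<close>

lemma value_at_cone_form [simp]: "value_at x y z (cone_form a b c) = a * x + b * y + c * z"
  by (simp add: cone_form_def)

lemma homogeneous_cone_form: "homogeneous 1 (cone_form a b c)"
  using homogeneous_mult[OF homogeneous_Const homogeneous_XYZ(1)]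
    homogeneous_mult[OF homogeneous_Const homogeneous_XYZ(2)]
    homogeneous_mult[OF homogeneous_Const homogeneous_XYZ(3)]
  unfolding cone_form_def by (intro homogeneous_add) auto

lemma cone_form_eq_0_iff: "cone_form a b c = 0 \<longleftrightarrow> a = 0 \<and> b = 0 \<and> c = 0"
proof
  assume "cone_form a b c = 0"
  then have "value_at x y z (cone_form a b c) = 0" for x y z
    by simp
  from this[of 1 0 0] this[of 0 1 0] this[of 0 0 1] show "a = 0 \<and> b = 0 \<and> c = 0"
    by simp
qed (simp add: cone_form_def Const_simps)

lemma cone_form_dvd_cone_form:
  assumes "cone_form a b c dvd cone_form a' b' c'" "(a, b) \<noteq> (0, 0)"
  obtains e where "a' = e * a" "b' = e * b" "c' = e * c"
proof -
  obtain k where k: "cone_form a' b' c' = cone_form a b c * k"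
    using assms(1) by (elim dvdE)
  have "cone_form a b c \<noteq> 0"
    using assms(2) by (auto simp: cone_form_eq_0_iff)
  then obtain e where "k = Const e"
    using k by (metis homogeneous_cone_form homogeneous_quotient_same_degree)
  then have "value_at x y z (cone_form a' b' c') = e * value_at x y z (cone_form a b c)" for x y z
    using k by simp
  from this[of 1 0 0] this[of 0 1 0] this[of 0 0 1] show ?thesis
    using that[of e] by simp
qed

text \<open>
  The Frobenius field is tangent to every line: \<open>a frob x + b frob y = frob (a x + b y + c z)\<close>. The
  difference of both sides vanishes on the plane and has degree \<open>q\<close>, so it is a combination of
  \<open>frob x\<close> and \<open>frob y\<close> with constant coefficients. These are read off at \<open>(1, 0, 0)\<close> and \<open>(0, 1, 0)\<close>,
  where \<open>frob p\<close> and \<open>p\<close> agree because \<open>t\<^sup>q = t\<close> in the field.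
\<close>

lemma cone_form_dvd_frob:
  fixes a b c :: "'a::{field,finite}"
  shows "cone_form a b c dvd Const a * frob X\<^sub>3 + Const b * frob Y\<^sub>3"
proof -
  define g where "g = frob (cone_form a b c) - (Const a * frob X\<^sub>3 + Const b * frob Y\<^sub>3)"
  have "homogeneous (0 + CARD('a)) (Const a * frob X\<^sub>3)" "homogeneous (0 + CARD('a)) (Const b * frob Y\<^sub>3)"
    by (intro homogeneous_mult homogeneous_Const homogeneous_frob homogeneous_XYZ)+
  then have hom: "homogeneous (CARD('a)) g"
    unfolding g_def by (intro homogeneous_diff homogeneous_add homogeneous_frob homogeneous_cone_form) auto
  have van: "value_at x y 1 g = 0" for x y
    by (simp add: g_def value_at_frob)
  obtain A B where AB: "homogeneous 0 A" "homogeneous 0 B" "g = frob X\<^sub>3 * A + frob Y\<^sub>3 * B"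
    using vanishing_in_frob_ideal[OF hom van] by auto
  have hom1: "homogeneous 0 (1::'a poly3)"
    using homogeneous_Const[of 1] by (simp add: Const_simps)
  obtain a' where A: "A = Const a'"
    using homogeneous_quotient_same_degree[OF hom1, of A] AB(1) by auto
  obtain b' where B: "B = Const b'"
    using homogeneous_quotient_same_degree[OF hom1, of B] AB(2) by auto
  have q: "CARD('a) > 0" "CARD('a) - 1 > 0"
    using card_field_ge_2[where 'a = 'a] by auto
  have "value_at x y 0 (frob p) = value_at x y 0 p" for x y :: 'a and p
    using q by (simp add: frob_def field_power_card_eq_same)
  then have "value_at 1 0 0 g = 0" "value_at 0 1 0 g = 0"
    and "value_at 1 0 0 g = a'" "value_at 0 1 0 g = b'"
    by (simp add: g_def, simp add: g_def, simp add: AB(3) A B, simp add: AB(3) A B)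
  then have "a' = 0" "b' = 0"
    by metis+
  then have "g = 0"
    by (simp add: AB(3) A B Const_simps)
  then have "Const a * frob X\<^sub>3 + Const b * frob Y\<^sub>3 = frob (cone_form a b c)"
    by (simp add: g_def)
  also have "cone_form a b c dvd \<dots>"
    using q(1) by (auto simp: frob_def intro!: dvd_diff dvd_power)
  finally show ?thesis .
qed

text \<open>
  Solving the equation of the line for \<open>x\<close> or for \<open>y\<close> identifies the residue ring modulo its form with
  a subring of the domain \<open>S\<close>. The other variable survives, so the Frobenius field does not vanish
  identically along the line.
\<close>

lemma cone_form_retraction:
  fixes a b c :: "'a::{field,finite}"
  assumes "(a, b) \<noteq> (0, 0)"
  obtains \<tau> :: "'a poly3 \<Rightarrow> 'a poly3" where "unital_hom \<tau>"
    "\<And>p. cone_form a b c dvd p \<longleftrightarrow> \<tau> p = 0" "\<tau> (frob X\<^sub>3) \<noteq> 0 \<or> \<tau> (frob Y\<^sub>3) \<noteq> 0"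
proof -
  let ?\<alpha> = "cone_form a b c"
  note result = that
  have *: thesis
    if *: "?\<alpha> dvd X\<^sub>3 - x" "?\<alpha> dvd Y\<^sub>3 - y" "Const a * x + Const b * y + Const c * Z\<^sub>3 = 0"
      and **: "x = X\<^sub>3 \<or> y = Y\<^sub>3" for x y
  proof -
    define \<tau> where "\<tau> = subst3 Const x y (Z\<^sub>3 :: 'a poly3)"
    have hom: "unital_hom \<tau>"
      unfolding \<tau>_def by (intro unital_hom_subst3 unital_hom_Const)
    note h = unital_homD[OF hom]
    have s [simp]: "\<tau> (Const e) = Const e" "\<tau> X\<^sub>3 = x" "\<tau> Y\<^sub>3 = y" "\<tau> Z\<^sub>3 = Z\<^sub>3" for e
      by (simp_all add: \<tau>_def subst3_simps unital_hom_Const)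
    have cong: "?\<alpha> dvd p - \<tau> p" for p
    proof (induction p rule: poly3_induct)
      case (add p q)
      have "p + q - \<tau> (p + q) = (p - \<tau> p) + (q - \<tau> q)"
        by (simp only: h) simp
      with add show ?case by (simp only: dvd_add)
    next
      case (mult p q)
      have "p * q - \<tau> (p * q) = p * (q - \<tau> q) + (p - \<tau> p) * \<tau> q"
        by (simp only: h algebra_simps)
      with mult show ?case by (simp only: dvd_add dvd_mult dvd_mult2)
    qed (use *(1,2) in simp_all)
    have "\<tau> ?\<alpha> = 0"
      using *(3) by (simp add: cone_form_def h)
    have dvd: "?\<alpha> dvd p \<longleftrightarrow> \<tau> p = 0" for p
    proof
      assume "?\<alpha> dvd p"
      then obtain k where "p = ?\<alpha> * k" ..
      with \<open>\<tau> ?\<alpha> = 0\<close> show "\<tau> p = 0"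
        by (simp only: h mult_zero_left)
    next
      assume "\<tau> p = 0"
      with cong[of p] show "?\<alpha> dvd p"
        by (simp only: diff_zero)
    qed
    have "value_at 1 0 0 (frob X\<^sub>3 :: 'a poly3) = 1" "value_at 0 1 0 (frob Y\<^sub>3 :: 'a poly3) = 1"
      using card_field_ge_2[where 'a = 'a] by (simp_all add: frob_def)
    then have "frob X\<^sub>3 \<noteq> (0::'a poly3)" "frob Y\<^sub>3 \<noteq> (0::'a poly3)"
      by auto
    moreover have "\<tau> (frob X\<^sub>3) = frob x" "\<tau> (frob Y\<^sub>3) = frob y"
      by (simp_all add: frob_def h)
    ultimately have "\<tau> (frob X\<^sub>3) \<noteq> 0 \<or> \<tau> (frob Y\<^sub>3) \<noteq> 0"
      using ** by metis
    show thesis by (rule result[OF hom dvd]) fact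
  qed
  show thesis
  proof (cases "a = 0")
    case False
    define x where "x = Const (- (b / a)) * Y\<^sub>3 + Const (- (c / a)) * Z\<^sub>3"
    have "Const a * x + Const b * Y\<^sub>3 + Const c * Z\<^sub>3 =
        Const (a * (- (b / a)) + b) * Y\<^sub>3 + Const (a * (- (c / a)) + c) * Z\<^sub>3"
      by (simp only: x_def Const_simps(3,4) algebra_simps)
    then have 1: "Const a * x + Const b * Y\<^sub>3 + Const c * Z\<^sub>3 = 0"
      using False by (simp add: Const_simps)
    have "Const (1 / a) * ?\<alpha> = Const (1 / a * a) * X\<^sub>3 + Const (1 / a * b) * Y\<^sub>3 + Const (1 / a * c) * Z\<^sub>3"
      by (simp only: cone_form_def Const_simps(4) algebra_simps)
    also have "\<dots> = X\<^sub>3 - x"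
      using False by (simp add: x_def Const_simps(2,6))
    finally have "X\<^sub>3 - x = Const (1 / a) * ?\<alpha>" ..
    then have "?\<alpha> dvd X\<^sub>3 - x" by (simp only: dvd_triv_right)
    then show thesis by (rule *[OF _ _ 1]) simp_all
  next
    case True
    with assms have "b \<noteq> 0" by simp
    define y where "y = Const (- (a / b)) * X\<^sub>3 + Const (- (c / b)) * Z\<^sub>3"
    have "Const a * X\<^sub>3 + Const b * y + Const c * Z\<^sub>3 =
        Const (b * (- (a / b)) + a) * X\<^sub>3 + Const (b * (- (c / b)) + c) * Z\<^sub>3"
      by (simp only: y_def Const_simps(3,4) algebra_simps)
    then have 1: "Const a * X\<^sub>3 + Const b * y + Const c * Z\<^sub>3 = 0"
      using \<open>b \<noteq> 0\<close> by (simp add: Const_simps)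
    have "Const (1 / b) * ?\<alpha> = Const (1 / b * a) * X\<^sub>3 + Const (1 / b * b) * Y\<^sub>3 + Const (1 / b * c) * Z\<^sub>3"
      by (simp only: cone_form_def Const_simps(4) algebra_simps)
    also have "\<dots> = Y\<^sub>3 - y"
      using \<open>b \<noteq> 0\<close> by (simp add: y_def Const_simps(2,6))
    finally have "Y\<^sub>3 - y = Const (1 / b) * ?\<alpha>" ..
    then have "?\<alpha> dvd Y\<^sub>3 - y" by (simp only: dvd_triv_right)
    then show thesis by (rule *[OF _ _ 1, rotated]) simp_all
  qed
qed


lemma prime_elem_cone_form:
  fixes a b c :: "'a::{field,finite}"
  assumes "(a, b) \<noteq> (0, 0)"
  shows "prime_elem (cone_form a b c)"
proof -
  obtain \<tau> :: "'a poly3 \<Rightarrow> 'a poly3" where \<tau>: "unital_hom \<tau>"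
      "\<And>p. cone_form a b c dvd p \<longleftrightarrow> \<tau> p = 0"
    using cone_form_retraction[OF assms] by metis
  show ?thesis
    using assms by (intro prime_elemI) (auto simp: \<tau>(2) unital_homD[OF \<tau>(1)] cone_form_eq_0_iff)
qed

text \<open>
  Along the line the field \<open>(P, Q)\<close> is parallel to the Frobenius field, which is tangent to the line and
  not identically zero there.
\<close>

lemma tangent_if_det_frob:
  fixes a b c :: "'a::{field,finite}"
  assumes ab: "(a, b) \<noteq> (0, 0)"
    and dvd: "cone_form a b c dvd P * frob Y\<^sub>3 - Q * frob X\<^sub>3"
  shows "cone_form a b c dvd Const a * P + Const b * Q"
proof -
  let ?u = "frob X\<^sub>3 :: 'a poly3" and ?v = "frob Y\<^sub>3 :: 'a poly3" and ?\<alpha> = "cone_form a b c"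
  have "?v * (Const a * P + Const b * Q) =
      Const a * (P * ?v - Q * ?u) + Q * (Const a * ?u + Const b * ?v)"
    by (simp add: algebra_simps)
  then have v: "?\<alpha> dvd ?v * (Const a * P + Const b * Q)"
    using dvd cone_form_dvd_frob[of a b c] by simp
  have "?u * (Const a * P + Const b * Q) =
      P * (Const a * ?u + Const b * ?v) - Const b * (P * ?v - Q * ?u)"
    by (simp add: algebra_simps)
  then have u: "?\<alpha> dvd ?u * (Const a * P + Const b * Q)"
    using dvd cone_form_dvd_frob[of a b c] by (simp add: dvd_diff)
  have "\<not> ?\<alpha> dvd ?u \<or> \<not> ?\<alpha> dvd ?v"
    using cone_form_retraction[OF ab, of c] by metis
  then show ?thesis
    using u v prime_elem_dvd_mult_iff[OF prime_elem_cone_form[OF ab]] by blast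
qed

text \<open>
  Along the line both fields are multiples of its direction.
\<close>

lemma det_dvd_if_tangent:
  fixes a b c :: "'a::{field,finite}"
  assumes ab: "(a, b) \<noteq> (0, 0)"
    and 1: "cone_form a b c dvd Const a * P + Const b * Q"
    and 2: "cone_form a b c dvd Const a * P' + Const b * Q'"
  shows "cone_form a b c dvd P * Q' - Q * P'"
proof -
  let ?\<alpha> = "cone_form a b c"
  have "Const a * (P * Q' - Q * P') =
      Q' * (Const a * P + Const b * Q) - Q * (Const a * P' + Const b * Q')"
    by (simp add: algebra_simps)
  then have a: "?\<alpha> dvd Const a * (P * Q' - Q * P')"
    using 1 2 by (simp add: dvd_diff)
  have "Const b * (P * Q' - Q * P') =
      P * (Const a * P' + Const b * Q') - P' * (Const a * P + Const b * Q)"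
    by (simp add: algebra_simps)
  then have b: "?\<alpha> dvd Const b * (P * Q' - Q * P')"
    using 1 2 by (simp add: dvd_diff)
  have cancel: "x dvd y" if "x dvd Const e * y" "e \<noteq> 0" for e and x y :: "'a poly3"
  proof -
    have "Const (1 / e) * (Const e * y) = Const (1 / e * e) * y"
      by (simp only: Const_simps(4) mult.assoc)
    then have "y = Const (1 / e) * (Const e * y)"
      using that(2) by (simp add: Const_simps(2))
    then show ?thesis
      using that(1) by (metis dvd_mult)
  qed
  from ab consider "a \<noteq> 0" | "b \<noteq> 0" by auto
  then show ?thesis
    using cancel[OF a] cancel[OF b] by cases
qed

lemma prime_elem_dvd_prod:
  assumes "prime_elem p" "finite A" "p dvd prod f A"
  obtains x where "x \<in> A" "p dvd f x"
proof -
  have "p dvd prod f A \<Longrightarrow> \<exists>x\<in>A. p dvd f x"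
    using assms(2)
    by (induction A) (use assms(1) in \<open>auto simp: prime_elem_dvd_mult_iff dest: prime_elem_not_unit\<close>)
  with assms(3) that show ?thesis by blast
qed

text \<open>
  The usual statement about pairwise nonassociated primes. Prime elements suffice, so that no
  factorization theory for \<open>S\<close> has to be set up.
\<close>

lemma prod_dvd_if_pairwise_prime:
  fixes f :: "'i \<Rightarrow> 'b::idom"
  assumes "finite A" "\<And>x. x \<in> A \<Longrightarrow> prime_elem (f x)" "\<And>x. x \<in> A \<Longrightarrow> f x dvd g"
    "\<And>x y. x \<in> A \<Longrightarrow> y \<in> A \<Longrightarrow> f x dvd f y \<Longrightarrow> x = y"
  shows "prod f A dvd g"
  using assms
proof (induction A)
  case (insert x A)
  then have "prod f A dvd g" by auto
  then obtain h where h: "g = prod f A * h" by (elim dvdE)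
  have "\<not> f x dvd prod f A"
  proof
    assume "f x dvd prod f A"
    then obtain y where "y \<in> A" "f x dvd f y"
      using insert.prems(1) insert.hyps(1) by (auto elim: prime_elem_dvd_prod)
    with insert show False by blast
  qed
  then have "f x dvd h"
    using insert.prems(1,2)[of x] prime_elem_dvd_mult_iff[of "f x" "prod f A" h] h by auto
  with insert.hyps show ?case
    by (auto simp: h mult.commute intro: mult_dvd_mono)
qed simp


section \<open>Lines and their defining forms\<close>

lemma mem_zero_locus: "v \<in> zero_locus a b c \<longleftrightarrow> value_at (v $ 1) (v $ 2) 1 (cone_form a b c) = 0"
  by (simp add: zero_locus_def)

text \<open>
  The two coefficient vectors are compared at two points of the line.
\<close>

lemma zero_locus_eqD:
  assumes "zero_locus a b c = zero_locus a' b' c'" "(a, b) \<noteq> (0, 0)"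
  obtains e where "a' = e * a" "b' = e * b" "c' = e * c"
proof -
  have *: "a * x + b * y + c = 0 \<longleftrightarrow> a' * x + b' * y + c' = 0" for x y
    using assms(1) by (auto simp: zero_locus_def set_eq_iff dest: spec[of _ "vector [x, y]"])
  show ?thesis
  proof (cases "a = 0")
    case False
    have "a' * (- c / a) + c' = 0" "a' * (- (b + c) / a) + b' + c' = 0"
      using *[of "- c / a" 0] *[of "- (b + c) / a" 1] False by (simp_all add: field_simps)
    with False that[of "a' / a"] show ?thesis
      by (simp add: field_simps)
  next
    case True
    with assms(2) have b: "b \<noteq> 0" by simp
    have "b' * (- c / b) + c' = 0" "a' + b' * (- (a + c) / b) + c' = 0"
      using *[of 0 "- c / b"] *[of 1 "- (a + c) / b"] b by (simp_all add: field_simps)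
    with b that[of "b' / b"] show ?thesis
      by (simp add: field_simps)
  qed
qed

lemma cone_form_dvd_if_same_line:
  assumes "zero_locus a b c = zero_locus a' b' c'" "(a, b) \<noteq> (0, 0)"
  shows "cone_form a b c dvd cone_form a' b' c'"
proof -
  obtain e where "a' = e * a" "b' = e * b" "c' = e * c"
    using zero_locus_eqD[OF assms] .
  then have "cone_form a' b' c' = Const e * cone_form a b c"
    by (simp only: cone_form_def Const_simps(4) algebra_simps)
  then show ?thesis by simp
qed

text \<open>
  Some equation of the line; the choices differ by a nonzero constant
  (\<open>zero_locus_eqD\<close>).
\<close>

definition line_form :: "('a::field^2) set \<Rightarrow> 'a poly3" where
  "line_form H = (SOME p. \<exists>a b c. (a, b) \<noteq> (0, 0) \<and> H = zero_locus a b c \<and> p = cone_form a b c)"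

lemma line_formE:
  assumes "is_line H"
  obtains a b c where "(a, b) \<noteq> (0, 0)" "H = zero_locus a b c" "line_form H = cone_form a b c"
proof -
  have "\<exists>p a b c. (a, b) \<noteq> (0, 0) \<and> H = zero_locus a b c \<and> p = cone_form a b c"
    using assms by (auto simp: is_line_def)
  from someI_ex[OF this] that show ?thesis
    unfolding line_form_def by blast
qed

lemma value_at_line_form:
  assumes "is_line H"
  shows "value_at (v $ 1) (v $ 2) 1 (line_form H) = 0 \<longleftrightarrow> v \<in> H"
  using line_formE[OF assms] mem_zero_locus by metis

lemma line_form_dvd_line_form:
  assumes "is_line H" "is_line H'" "line_form H dvd line_form H'"
  shows "H = H'"
proof -
  obtain a b c where 1: "(a, b) \<noteq> (0, 0)" "H = zero_locus a b c" "line_form H = cone_form a b c"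
    using line_formE[OF assms(1)] .
  obtain a' b' c' where 2: "(a', b') \<noteq> (0, 0)" "H' = zero_locus a' b' c'"
      "line_form H' = cone_form a' b' c'"
    using line_formE[OF assms(2)] .
  obtain e where e: "a' = e * a" "b' = e * b" "c' = e * c"
    using cone_form_dvd_cone_form 1 2 assms(3) by metis
  with 2(1) have "e \<noteq> 0" by auto
  have "a' * x + b' * y + c' = e * (a * x + b * y + c)" for x y
    by (simp add: e algebra_simps)
  with \<open>e \<noteq> 0\<close> show ?thesis
    unfolding 1(2) 2(2) zero_locus_def by simp
qed

definition defining_poly :: "('a::field^2) set set \<Rightarrow> 'a poly3" where
  "defining_poly \<A> = (\<Prod>H\<in>\<A>. line_form H)"

lemma homogeneous_defining_poly:
  assumes "line_arrangement \<A>"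
  shows "homogeneous (card \<A>) (defining_poly \<A>)"
  unfolding defining_poly_def
proof (rule homogeneous_prod)
  fix H assume "H \<in> \<A>"
  then show "homogeneous 1 (line_form H)"
    using assms homogeneous_cone_form by (metis line_arrangement_def line_formE)
qed (use assms in \<open>simp add: line_arrangement_def\<close>)

lemma value_at_defining_poly:
  assumes "line_arrangement \<A>"
  shows "value_at (v $ 1) (v $ 2) 1 (defining_poly \<A>) = 0 \<longleftrightarrow> v \<in> \<Union>\<A>"
  using assms by (auto simp: defining_poly_def line_arrangement_def value_at_line_form)

lemma defining_poly_nonzero:
  assumes "line_arrangement \<A>"
  shows "defining_poly \<A> \<noteq> 0"
  using assms
  by (auto simp: defining_poly_def line_arrangement_def cone_form_eq_0_iff elim!: line_formE)

lemma cone_form_dvd_defining_poly: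
  assumes "line_arrangement \<A>" "zero_locus a b c \<in> \<A>" "(a, b) \<noteq> (0, 0)"
  shows "cone_form a b c dvd defining_poly \<A>"
proof -
  have "is_line (zero_locus a b c)"
    using assms(3) by (auto simp: is_line_def)
  then have "cone_form a b c dvd line_form (zero_locus a b c)"
    using assms(3) by (metis line_formE cone_form_dvd_if_same_line)
  also have "\<dots> dvd defining_poly \<A>"
    using assms(1,2) by (auto simp: defining_poly_def line_arrangement_def intro: dvd_prodI)
  finally show ?thesis .
qed


section \<open>Derivations and Saito's criterion\<close>

definition leibniz :: "('b::comm_ring_1 \<Rightarrow> 'b) \<Rightarrow> bool" where
  "leibniz D \<longleftrightarrow> (\<forall>p q. D (p + q) = D p + D q) \<and> (\<forall>p q. D (p * q) = p * D q + q * D p)"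

lemma leibniz_map_poly:
  assumes "leibniz D"
  shows "leibniz (map_poly D)"
proof -
  have D: "D (p + q) = D p + D q" "D (p * q) = p * D q + q * D p" for p q
    using assms by (auto simp: leibniz_def)
  have D0: "D 0 = 0"
    using D(2)[of 0 0] by simp
  have add: "map_poly D (p + q) = map_poly D p + map_poly D q" for p q
    by (rule poly_eqI) (simp add: coeff_map_poly D D0)
  have smult: "map_poly D (smult a q) = smult a (map_poly D q) + smult (D a) q" for a q
    by (rule poly_eqI) (simp add: coeff_map_poly D D0 mult.commute)
  have "map_poly D (p * q) = p * map_poly D q + q * map_poly D p" for p q
  proof (induction p)
    case (pCons a p)
    have "map_poly D (pCons a p * q) = map_poly D (smult a q) + pCons 0 (map_poly D (p * q))"
      by (simp add: add map_poly_pCons D0)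
    moreover have "pCons 0 (x + y) = pCons 0 x + pCons 0 y" for x y :: "'a poly"
      by simp
    ultimately show ?case
      by (simp add: pCons.IH smult map_poly_pCons D0 algebra_simps del: add_pCons)
  qed simp
  with add show ?thesis
    by (simp add: leibniz_def)
qed

lemma leibniz_pderiv: "leibniz (pderiv :: 'b::idom poly \<Rightarrow> 'b poly)"
  by (simp add: leibniz_def pderiv_add pderiv_mult add.commute mult.commute)

definition vector_field ::
    "'a::field poly3 \<Rightarrow> 'a poly3 \<Rightarrow> 'a poly3 \<Rightarrow> 'a poly3 \<Rightarrow> 'a poly3" where
  "vector_field P Q R p = P * map_poly (map_poly pderiv) p + Q * map_poly pderiv p + R * pderiv p"

lemma euler_eq_vector_field: "euler = vector_field X\<^sub>3 Y\<^sub>3 Z\<^sub>3"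
  by (simp add: fun_eq_iff euler_def vector_field_def)

lemma vector_field_simps [simp]:
  "vector_field P Q R X\<^sub>3 = P" "vector_field P Q R Y\<^sub>3 = Q" "vector_field P Q R Z\<^sub>3 = R"
  "vector_field P Q R (Const c) = 0"
  by (simp_all add: vector_field_def X\<^sub>3_def Y\<^sub>3_def Z\<^sub>3_def Const_def map_poly_pCons pderiv_pCons
      map_poly_1 flip: one_pCons)

lemma derivation_vector_field: "derivation (vector_field P Q R)"
proof -
  have l: "leibniz (map_poly (map_poly pderiv) :: 'a poly3 \<Rightarrow> _)"
    "leibniz (map_poly pderiv :: 'a poly3 \<Rightarrow> _)" "leibniz (pderiv :: 'a poly3 \<Rightarrow> _)"
    by (intro leibniz_map_poly leibniz_pderiv)+
  then have "vector_field P Q R (p + q) = vector_field P Q R p + vector_field P Q R q"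
    and mult: "vector_field P Q R (p * q) = p * vector_field P Q R q + q * vector_field P Q R p" for p q
    by (simp_all add: leibniz_def vector_field_def algebra_simps)
  moreover have "vector_field P Q R (Const c * p) = Const c * vector_field P Q R p" for c p
    by (simp add: mult)
  ultimately show ?thesis
    by (simp add: derivation_def)
qed

lemma derivation_Const:
  assumes "derivation \<theta>"
  shows "\<theta> (Const c) = 0"
proof -
  have "\<theta> (1 * 1) = 1 * \<theta> 1 + 1 * \<theta> 1"
    using assms unfolding derivation_def by blast
  then have "\<theta> 1 = 0"
    by (simp only: mult_1_left mult_1_right add_cancel_left_left add_cancel_right_right)
  moreover have "\<theta> (Const c * 1) = Const c * \<theta> 1"
    using assms unfolding derivation_def by blast
  ultimately show ?thesis by simp
qed

lemma derivation_eqI: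
  assumes "derivation \<theta>" "derivation \<theta>'" "\<theta> X\<^sub>3 = \<theta>' X\<^sub>3" "\<theta> Y\<^sub>3 = \<theta>' Y\<^sub>3" "\<theta> Z\<^sub>3 = \<theta>' Z\<^sub>3"
  shows "\<theta> = \<theta>'"
proof
  fix p show "\<theta> p = \<theta>' p"
  proof (induction p rule: poly3_induct)
    case (Const c)
    then show ?case using assms(1,2) by (simp add: derivation_Const)
  qed (use assms in \<open>simp_all add: derivation_def\<close>)
qed

lemma derivation_eq_vector_field:
  assumes "derivation \<theta>"
  shows "\<theta> = vector_field (\<theta> X\<^sub>3) (\<theta> Y\<^sub>3) (\<theta> Z\<^sub>3)"
  by (rule derivation_eqI) (simp_all add: assms derivation_vector_field)

lemma vector_field_cone_form:
  "vector_field P Q R (cone_form a b c) = Const a * P + Const b * Q + Const c * R"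
proof -
  let ?\<theta> = "vector_field P Q R"
  have "?\<theta> (p + q) = ?\<theta> p + ?\<theta> q" "?\<theta> (Const e * p) = Const e * ?\<theta> p" for p q e
    using derivation_vector_field[of P Q R] by (auto simp: derivation_def)
  then show ?thesis
    by (simp add: cone_form_def)
qed

text \<open>
  The condition defining logarithmic derivations, for a derivation \<open>P \<partial>\<^sub>x + Q \<partial>\<^sub>y\<close> that kills \<open>z\<close>. Modulo
  the Euler derivation every logarithmic derivation of the cone has this form.
\<close>

definition tangent_to :: "('a::field^2) set set \<Rightarrow> 'a poly3 \<Rightarrow> 'a poly3 \<Rightarrow> bool" where
  "tangent_to \<A> P Q \<longleftrightarrow> (\<forall>a b c. (a, b) \<noteq> (0, 0) \<longrightarrow> zero_locus a b c \<in> \<A> \<longrightarrow>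
     cone_form a b c dvd Const a * P + Const b * Q)"

lemma defining_poly_dvd_det:
  fixes \<A> :: "('a::{field,finite}^2) set set"
  assumes \<A>: "line_arrangement \<A>" and 1: "tangent_to \<A> P Q" and 2: "tangent_to \<A> P' Q'"
  shows "defining_poly \<A> dvd P * Q' - Q * P'"
  unfolding defining_poly_def
proof (rule prod_dvd_if_pairwise_prime)
  show "finite \<A>" using \<A> by (simp add: line_arrangement_def)
next
  fix H assume "H \<in> \<A>"
  then have "is_line H" using \<A> by (simp add: line_arrangement_def)
  then obtain a b c where H: "(a, b) \<noteq> (0, 0)" "H = zero_locus a b c" "line_form H = cone_form a b c"
    by (rule line_formE)
  show "prime_elem (line_form H)"
    unfolding H(3) by (rule prime_elem_cone_form[OF H(1)])
  show "line_form H dvd P * Q' - Q * P'"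
    unfolding H(3) using 1 2 H \<open>H \<in> \<A>\<close>
    by (intro det_dvd_if_tangent[OF H(1)]) (auto simp: tangent_to_def)
next
  fix H H' assume "H \<in> \<A>" "H' \<in> \<A>" "line_form H dvd line_form H'"
  then show "H = H'"
    using \<A> line_form_dvd_line_form by (auto simp: line_arrangement_def)
qed

text \<open>
  Subtracting a multiple of the Euler derivation from a logarithmic derivation leaves a tangent field
  \<open>(P, Q)\<close>. Cramer's rule expresses \<open>(P, Q)\<close> through the two given fields with coefficients
  \<open>(P Q\<^sub>2 - Q P\<^sub>2) / (e f)\<close> and \<open>(P\<^sub>1 Q - Q\<^sub>1 P) / (e f)\<close>, and these are polynomials because \<open>f\<close> divides
  the determinant of any two tangent fields.
\<close>

theorem saito_criterion:
  fixes \<A> :: "('a::{field,finite}^2) set set"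
  assumes \<A>: "line_arrangement \<A>"
    and tan: "tangent_to \<A> P\<^sub>1 Q\<^sub>1" "tangent_to \<A> P\<^sub>2 Q\<^sub>2"
    and hom: "homogeneous d\<^sub>1 P\<^sub>1" "homogeneous d\<^sub>1 Q\<^sub>1" "homogeneous d\<^sub>2 P\<^sub>2" "homogeneous d\<^sub>2 Q\<^sub>2"
    and det: "P\<^sub>1 * Q\<^sub>2 - Q\<^sub>1 * P\<^sub>2 = defining_poly \<A> * Const e" and e: "e \<noteq> 0"
  shows "free_arrangement \<A>"
proof -
  let ?f = "defining_poly \<A>" and ?d = "P\<^sub>1 * Q\<^sub>2 - Q\<^sub>1 * P\<^sub>2"
  define \<theta>\<^sub>1 where "\<theta>\<^sub>1 = vector_field P\<^sub>1 Q\<^sub>1 0"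
  define \<theta>\<^sub>2 where "\<theta>\<^sub>2 = vector_field P\<^sub>2 Q\<^sub>2 0"
  have f0: "?f \<noteq> 0"
    using \<A> by (rule defining_poly_nonzero)
  have d0: "?d \<noteq> 0"
    unfolding det using f0 e by (simp add: Const_def)
  have Z0: "Z\<^sub>3 \<noteq> (0 :: 'a poly3)"
    by (simp add: Z\<^sub>3_def)
  have distinct: "euler \<noteq> \<theta>\<^sub>1" "euler \<noteq> \<theta>\<^sub>2" "\<theta>\<^sub>1 \<noteq> \<theta>\<^sub>2"
  proof -
    show "euler \<noteq> \<theta>\<^sub>1" "euler \<noteq> \<theta>\<^sub>2"
      using Z0 by (metis euler_eq_vector_field \<theta>\<^sub>1_def \<theta>\<^sub>2_def vector_field_simps(3))+
    show "\<theta>\<^sub>1 \<noteq> \<theta>\<^sub>2"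
    proof
      assume "\<theta>\<^sub>1 = \<theta>\<^sub>2"
      then have "P\<^sub>1 = P\<^sub>2" "Q\<^sub>1 = Q\<^sub>2"
        by (metis \<theta>\<^sub>1_def \<theta>\<^sub>2_def vector_field_simps(1), metis \<theta>\<^sub>1_def \<theta>\<^sub>2_def vector_field_simps(2))
      with d0 show False by (simp add: mult.commute)
    qed
  qed
  have comb: "der_scale k \<theta> p = k * \<theta> p" for k \<theta> and p :: "'a poly3"
    by (simp add: der_scale_def)
  have indep: "der.independent {euler, \<theta>\<^sub>1, \<theta>\<^sub>2}"
  proof
    assume "der.dependent {euler, \<theta>\<^sub>1, \<theta>\<^sub>2}"
    then obtain u where u: "\<exists>v\<in>{euler, \<theta>\<^sub>1, \<theta>\<^sub>2}. u v \<noteq> 0"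
      and sum: "(\<Sum>v\<in>{euler, \<theta>\<^sub>1, \<theta>\<^sub>2}. der_scale (u v) v) = 0"
      by (auto simp: der.dependent_finite)
    have "der_scale (u euler) euler + (der_scale (u \<theta>\<^sub>1) \<theta>\<^sub>1 + der_scale (u \<theta>\<^sub>2) \<theta>\<^sub>2) = 0"
      using sum distinct by simp
    then have *: "u euler * euler p + (u \<theta>\<^sub>1 * \<theta>\<^sub>1 p + u \<theta>\<^sub>2 * \<theta>\<^sub>2 p) = 0" for p
      by (simp add: fun_eq_iff comb)
    have ue: "u euler = 0"
      using *[of Z\<^sub>3] Z0 by (simp add: euler_eq_vector_field \<theta>\<^sub>1_def \<theta>\<^sub>2_def)
    have X: "u \<theta>\<^sub>1 * P\<^sub>1 + u \<theta>\<^sub>2 * P\<^sub>2 = 0" and Y: "u \<theta>\<^sub>1 * Q\<^sub>1 + u \<theta>\<^sub>2 * Q\<^sub>2 = 0"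
      using *[of X\<^sub>3] *[of Y\<^sub>3] by (simp_all add: ue) (simp_all add: \<theta>\<^sub>1_def \<theta>\<^sub>2_def)
    have "u \<theta>\<^sub>1 * ?d = (u \<theta>\<^sub>1 * P\<^sub>1 + u \<theta>\<^sub>2 * P\<^sub>2) * Q\<^sub>2 - (u \<theta>\<^sub>1 * Q\<^sub>1 + u \<theta>\<^sub>2 * Q\<^sub>2) * P\<^sub>2"
      "u \<theta>\<^sub>2 * ?d = P\<^sub>1 * (u \<theta>\<^sub>1 * Q\<^sub>1 + u \<theta>\<^sub>2 * Q\<^sub>2) - Q\<^sub>1 * (u \<theta>\<^sub>1 * P\<^sub>1 + u \<theta>\<^sub>2 * P\<^sub>2)"
      by (simp_all only: algebra_simps)
    then have "u \<theta>\<^sub>1 = 0" "u \<theta>\<^sub>2 = 0"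
      using d0 by (simp_all add: X Y)
    with u ue show False by simp
  qed
  have span_iff: "\<delta> \<in> der.span {euler, \<theta>\<^sub>1, \<theta>\<^sub>2} \<longleftrightarrow>
      (\<exists>k k\<^sub>1 k\<^sub>2. \<delta> = vector_field (k * X\<^sub>3 + k\<^sub>1 * P\<^sub>1 + k\<^sub>2 * P\<^sub>2) (k * Y\<^sub>3 + k\<^sub>1 * Q\<^sub>1 + k\<^sub>2 * Q\<^sub>2) (k * Z\<^sub>3))" for \<delta>
  proof -
    have "\<delta> - der_scale k euler - der_scale k\<^sub>1 \<theta>\<^sub>1 - der_scale k\<^sub>2 \<theta>\<^sub>2 = 0 \<longleftrightarrow>
      \<delta> = vector_field (k * X\<^sub>3 + k\<^sub>1 * P\<^sub>1 + k\<^sub>2 * P\<^sub>2) (k * Y\<^sub>3 + k\<^sub>1 * Q\<^sub>1 + k\<^sub>2 * Q\<^sub>2) (k * Z\<^sub>3)" for k k\<^sub>1 k\<^sub>2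
    proof -
      have "vector_field (k * X\<^sub>3 + k\<^sub>1 * P\<^sub>1 + k\<^sub>2 * P\<^sub>2) (k * Y\<^sub>3 + k\<^sub>1 * Q\<^sub>1 + k\<^sub>2 * Q\<^sub>2) (k * Z\<^sub>3) =
        der_scale k euler + der_scale k\<^sub>1 \<theta>\<^sub>1 + der_scale k\<^sub>2 \<theta>\<^sub>2"
        by (simp add: fun_eq_iff comb euler_eq_vector_field \<theta>\<^sub>1_def \<theta>\<^sub>2_def vector_field_def algebra_simps)
      then show ?thesis
        by (simp only: diff_diff_eq right_minus_eq add.assoc)
    qed
    then show ?thesis
      by (simp add: der.span_breakdown_eq)
  qed
  have "der.span {euler, \<theta>\<^sub>1, \<theta>\<^sub>2} = cone_derivations \<A>"
  proof (intro set_eqI iffI)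
    fix \<delta> assume "\<delta> \<in> der.span {euler, \<theta>\<^sub>1, \<theta>\<^sub>2}"
    then obtain k k\<^sub>1 k\<^sub>2 where \<delta>:
      "\<delta> = vector_field (k * X\<^sub>3 + k\<^sub>1 * P\<^sub>1 + k\<^sub>2 * P\<^sub>2) (k * Y\<^sub>3 + k\<^sub>1 * Q\<^sub>1 + k\<^sub>2 * Q\<^sub>2) (k * Z\<^sub>3)"
      unfolding span_iff by blast
    have "cone_form a b c dvd \<delta> (cone_form a b c)"
      if "zero_locus a b c \<in> \<A>" "(a, b) \<noteq> (0, 0)" for a b c
    proof -
      have "\<delta> (cone_form a b c) = k * cone_form a b c +
          k\<^sub>1 * (Const a * P\<^sub>1 + Const b * Q\<^sub>1) + k\<^sub>2 * (Const a * P\<^sub>2 + Const b * Q\<^sub>2)"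
        unfolding \<delta> vector_field_cone_form unfolding cone_form_def by (simp only: algebra_simps)
      moreover have "cone_form a b c dvd Const a * P\<^sub>1 + Const b * Q\<^sub>1"
        "cone_form a b c dvd Const a * P\<^sub>2 + Const b * Q\<^sub>2"
        using tan that unfolding tangent_to_def by blast+
      ultimately show ?thesis
        by (simp only: dvd_add dvd_mult dvd_triv_right)
    qed
    moreover have "derivation \<delta>" "Z\<^sub>3 dvd \<delta> Z\<^sub>3"
      by (simp_all add: \<delta> derivation_vector_field)
    ultimately show "\<delta> \<in> cone_derivations \<A>"
      unfolding cone_derivations_def by blast
  next
    fix \<delta> assume "\<delta> \<in> cone_derivations \<A>"
    then have der: "derivation \<delta>" and Z: "Z\<^sub>3 dvd \<delta> Z\<^sub>3"
      and dvd: "\<And>a b c. (a, b) \<noteq> (0, 0) \<Longrightarrow> zero_locus a b c \<in> \<A> \<Longrightarrow>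
        cone_form a b c dvd \<delta> (cone_form a b c)"
      unfolding cone_derivations_def by blast+
    obtain k where k: "\<delta> Z\<^sub>3 = Z\<^sub>3 * k"
      using Z ..
    define P where "P = \<delta> X\<^sub>3 - k * X\<^sub>3"
    define Q where "Q = \<delta> Y\<^sub>3 - k * Y\<^sub>3"
    have \<delta>: "\<delta> = vector_field (\<delta> X\<^sub>3) (\<delta> Y\<^sub>3) (\<delta> Z\<^sub>3)"
      using der by (rule derivation_eq_vector_field)
    have tanPQ: "tangent_to \<A> P Q"
      unfolding tangent_to_def
    proof (intro allI impI)
      fix a b c assume "(a, b) \<noteq> (0, 0)" "zero_locus a b c \<in> \<A>"
      then have "cone_form a b c dvd \<delta> (cone_form a b c) - k * cone_form a b c"
        by (intro dvd_diff dvd dvd_triv_right)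
      also have "\<delta> (cone_form a b c) = Const a * \<delta> X\<^sub>3 + Const b * \<delta> Y\<^sub>3 + Const c * \<delta> Z\<^sub>3"
        by (subst \<delta>) (rule vector_field_cone_form)
      also have "\<dots> - k * cone_form a b c = Const a * P + Const b * Q"
        unfolding k P_def Q_def cone_form_def by (simp add: algebra_simps)
      finally show "cone_form a b c dvd Const a * P + Const b * Q" .
    qed
    obtain m\<^sub>1 where m1: "P * Q\<^sub>2 - Q * P\<^sub>2 = ?f * m\<^sub>1"
      using defining_poly_dvd_det[OF \<A> tanPQ tan(2)] ..
    obtain m\<^sub>2 where m2: "P\<^sub>1 * Q - Q\<^sub>1 * P = ?f * m\<^sub>2"
      using defining_poly_dvd_det[OF \<A> tan(1) tanPQ] ..
    have solve: "R = Const (1 / e) * m\<^sub>1 * R\<^sub>1 + Const (1 / e) * m\<^sub>2 * R\<^sub>2"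
      if "?d * R = ?f * m\<^sub>1 * R\<^sub>1 + ?f * m\<^sub>2 * R\<^sub>2" for R R\<^sub>1 R\<^sub>2
    proof -
      have "?f * (Const e * R) = ?f * (m\<^sub>1 * R\<^sub>1 + m\<^sub>2 * R\<^sub>2)"
        using that unfolding det by (simp only: algebra_simps)
      then have *: "Const e * R = m\<^sub>1 * R\<^sub>1 + m\<^sub>2 * R\<^sub>2"
        using f0 by simp
      have "R = Const (1 / e * e) * R"
        using e by (simp add: Const_simps(2))
      also have "\<dots> = Const (1 / e) * (Const e * R)"
        by (simp only: Const_simps(4) mult.assoc)
      finally show ?thesis
        unfolding * by (simp only: algebra_simps)
    qed
    have "?d * P = (P * Q\<^sub>2 - Q * P\<^sub>2) * P\<^sub>1 + (P\<^sub>1 * Q - Q\<^sub>1 * P) * P\<^sub>2"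
      "?d * Q = (P * Q\<^sub>2 - Q * P\<^sub>2) * Q\<^sub>1 + (P\<^sub>1 * Q - Q\<^sub>1 * P) * Q\<^sub>2"
      by (simp_all add: algebra_simps)
    note this[unfolded m1 m2]
    then have PQ: "P = Const (1 / e) * m\<^sub>1 * P\<^sub>1 + Const (1 / e) * m\<^sub>2 * P\<^sub>2"
      "Q = Const (1 / e) * m\<^sub>1 * Q\<^sub>1 + Const (1 / e) * m\<^sub>2 * Q\<^sub>2"
      by - (rule solve, assumption)+
    have "\<delta> X\<^sub>3 = k * X\<^sub>3 + P" "\<delta> Y\<^sub>3 = k * Y\<^sub>3 + Q" "\<delta> Z\<^sub>3 = k * Z\<^sub>3"
      by (simp_all add: P_def Q_def k mult.commute)
    with \<delta> have "\<delta> = vector_field (k * X\<^sub>3 + P) (k * Y\<^sub>3 + Q) (k * Z\<^sub>3)"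
      by metis
    then show "\<delta> \<in> der.span {euler, \<theta>\<^sub>1, \<theta>\<^sub>2}"
      unfolding span_iff PQ add.assoc[symmetric] by blast
  qed
  moreover have "homogeneous_derivation d\<^sub>1 \<theta>\<^sub>1" "homogeneous_derivation d\<^sub>2 \<theta>\<^sub>2"
    using hom by (simp_all add: homogeneous_derivation_def \<theta>\<^sub>1_def \<theta>\<^sub>2_def derivation_vector_field)
  ultimately show ?thesis
    unfolding free_arrangement_def using distinct indep by auto
qed


section \<open>Counting points with the characteristic polynomial\<close>

lemma zero_locus_direction:
  fixes a b c :: "'a::field"
  assumes "v \<in> zero_locus a b c" "w \<in> zero_locus a b c"
  shows "a * (v $ 1 - w $ 1) = b * (w $ 2 - v $ 2)"
proof -
  have "(a * v $ 1 + b * v $ 2 + c) - (a * w $ 1 + b * w $ 2 + c) = 0"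
    using assms by (simp add: zero_locus_def)
  then show ?thesis
    by (simp add: algebra_simps)
qed

lemma zero_locus_param:
  fixes a b c :: "'a::field"
  assumes ab: "(a, b) \<noteq> (0, 0)" and v: "v \<in> zero_locus a b c"
  shows "zero_locus a b c = range (\<lambda>t. v + t *s vector [b, - a])"
proof (intro set_eqI iffI)
  fix w assume "w \<in> range (\<lambda>t. v + t *s vector [b, - a])"
  then obtain t where "w = v + t *s vector [b, - a]" by blast
  with v show "w \<in> zero_locus a b c"
    by (simp add: zero_locus_def vector_2 algebra_simps)
next
  fix w assume w: "w \<in> zero_locus a b c"
  have *: "a * (w $ 1 - v $ 1) = b * (v $ 2 - w $ 2)"
    using zero_locus_direction[OF w v] .
  define t where "t = (if b = 0 then (v $ 2 - w $ 2) / a else (w $ 1 - v $ 1) / b)"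
  have "w $ 1 = v $ 1 + t * b \<and> w $ 2 = v $ 2 + t * - a"
  proof (cases "b = 0")
    case True
    then show ?thesis using ab * by (auto simp: t_def)
  next
    case False
    then have "t * a = v $ 2 - w $ 2"
      using * by (simp add: t_def field_simps)
    with False show ?thesis by (simp add: t_def)
  qed
  then have "w = v + t *s vector [b, - a]"
    by (simp add: vec_eq_iff forall_2 vector_2)
  then show "w \<in> range (\<lambda>t. v + t *s vector [b, - a])" by blast
qed

lemma line_nonempty:
  assumes "(a, b) \<noteq> (0, 0 :: 'a::field)"
  shows "\<exists>v. v \<in> zero_locus a b c"
proof (cases "a = 0")
  case True
  with assms show ?thesis
    by (intro exI[of _ "vector [0, - c / b]"]) (simp add: zero_locus_def vector_2)
next
  case False
  then show ?thesis
    by (intro exI[of _ "vector [- c / a, 0]"]) (simp add: zero_locus_def vector_2)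
qed

lemma is_lineE:
  assumes "is_line H"
  obtains v d where "d \<noteq> 0" "H = range (\<lambda>t. v + t *s d)"
proof -
  obtain a b c where H: "(a, b) \<noteq> (0, 0)" "H = zero_locus a b c"
    using assms by (auto simp: is_line_def)
  obtain v where "v \<in> H"
    using line_nonempty H by blast
  moreover have "(vector [b, - a] :: 'a^2) \<noteq> 0"
    using H(1) by (auto simp: vec_eq_iff forall_2 vector_2)
  ultimately show ?thesis
    using zero_locus_param[OF H(1)] that H(2) by blast
qed

lemma card_line:
  fixes H :: "('a::{field,finite}^2) set"
  assumes "is_line H"
  shows "card H = CARD('a)"
proof -
  obtain v d where d: "d \<noteq> 0" and H: "H = range (\<lambda>t. v + t *s d)"
    using is_lineE[OF assms] .
  have "inj (\<lambda>t. v + t *s d)"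
    using d by (auto simp: inj_on_def vec.scale_right_imp_eq)
  then show ?thesis
    unfolding H by (simp add: card_image)
qed

lemma affine_dim_line:
  assumes "is_line H"
  shows "affine_dim H = 1"
proof -
  obtain v d where d: "d \<noteq> 0" and H: "H = range (\<lambda>t. v + t *s d)"
    using is_lineE[OF assms] .
  have "{u - w | u w. u \<in> H \<and> w \<in> H} = range (\<lambda>t. t *s d)"
  proof (intro set_eqI iffI)
    fix x assume "x \<in> {u - w | u w. u \<in> H \<and> w \<in> H}"
    then obtain t s where "x = (v + t *s d) - (v + s *s d)"
      unfolding H by blast
    then have "x = (t - s) *s d"
      by (simp add: vec.scale_left_diff_distrib)
    then show "x \<in> range (\<lambda>t. t *s d)" by blast
  next
    fix x assume "x \<in> range (\<lambda>t. t *s d)"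
    then obtain t where "x = (v + t *s d) - (v + 0 *s d)"
      by auto
    then show "x \<in> {u - w | u w. u \<in> H \<and> w \<in> H}"
      unfolding H by blast
  qed
  also have "\<dots> = vec.span {d}"
    by (simp add: vec.span_singleton)
  finally show ?thesis
    unfolding affine_dim_def using d by simp
qed

lemma affine_dim_UNIV: "affine_dim (UNIV :: ('a::field^2) set) = 2"
proof -
  have "{u - v | u v. u \<in> (UNIV :: ('a^2) set) \<and> v \<in> (UNIV :: ('a^2) set)} = UNIV"
    by (metis (mono_tags, lifting) UNIV_I UNIV_eq_I diff_zero mem_Collect_eq)
  then show ?thesis
    by (simp add: affine_dim_def vec.dim_UNIV card_cart_basis)
qed

lemma affine_dim_singleton: "affine_dim {v} = 0"
  by (simp add: affine_dim_def)

text \<open>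
  Both lines are parametrized from the common point \<open>v\<close>; the second point makes their directions
  proportional.
\<close>

lemma line_unique:
  assumes "is_line H" "is_line H'" "v \<in> H" "v \<in> H'" "w \<in> H" "w \<in> H'" "v \<noteq> w"
  shows "H = H'"
proof -
  obtain a b c where H: "(a, b) \<noteq> (0, 0)" "H = zero_locus a b c"
    using assms(1) by (auto simp: is_line_def)
  obtain a' b' c' where H': "(a', b') \<noteq> (0, 0)" "H' = zero_locus a' b' c'"
    using assms(2) by (auto simp: is_line_def)
  obtain t where w: "w = v + t *s vector [b, - a]"
    using zero_locus_param[OF H(1), of v c] assms(3,5) H(2) by blast
  obtain t' where w': "w = v + t' *s vector [b', - a']"
    using zero_locus_param[OF H'(1), of v c'] assms(4,6) H'(2) by blast
  have eq: "t * b = t' * b'" "t * a = t' * a'"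
    using w w' by (auto simp: vec_eq_iff forall_2 vector_2)
  have "t \<noteq> 0" "t' \<noteq> 0"
    using w w' assms(7) by auto
  then have "range (\<lambda>s. v + s *s vector [b, - a]) = range (\<lambda>s. v + s *s vector [b', - a'])"
  proof -
    have "s *s vector [b, - a] = (s / t * t') *s (vector [b', - a'] :: 'a^2)"
      "s *s vector [b', - a'] = (s / t' * t) *s (vector [b, - a] :: 'a^2)" for s
      using eq \<open>t \<noteq> 0\<close> \<open>t' \<noteq> 0\<close> by (simp_all add: vec_eq_iff forall_2 vector_2 field_simps)
    then show ?thesis
      by (metis (no_types, lifting) image_subset_iff rangeI subset_antisym)
  qed
  then show ?thesis
    using zero_locus_param[OF H(1)] zero_locus_param[OF H'(1)] H(2) H'(2) assms(3,4) by metis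
qed

lemma intersection_poset_cases:
  assumes "line_arrangement \<A>" "X \<in> intersection_poset \<A>"
  obtains "X = UNIV" | "X \<in> \<A>" | v where "X = {v}"
proof -
  obtain \<B> where \<B>: "\<B> \<subseteq> \<A>" "X = \<Inter>\<B>" "X \<noteq> {}"
    using assms(2) by (auto simp: intersection_poset_def)
  show ?thesis
  proof (cases "\<exists>H\<in>\<B>. \<exists>H'\<in>\<B>. H \<noteq> H'")
    case True
    then obtain H H' where HH: "H \<in> \<B>" "H' \<in> \<B>" "H \<noteq> H'" by blast
    obtain v where v: "v \<in> X" using \<B>(3) by blast
    have "w = v" if "w \<in> X" for w
    proof (rule ccontr)
      assume "w \<noteq> v"
      with line_unique[of H H' v w] HH v that \<B> assms(1) show False
        by (auto simp: line_arrangement_def)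
    qed
    with v that(3)[of v] show ?thesis by blast
  next
    case False
    then consider "\<B> = {}" | H where "\<B> = {H}" by blast
    then show ?thesis
      using that \<B> by cases auto
  qed
qed

lemma UNIV_in_intersection_poset: "UNIV \<in> intersection_poset \<A>"
  unfolding intersection_poset_def by (auto intro!: exI[of _ "{}"])

lemma line_in_intersection_poset:
  assumes "line_arrangement \<A>" "H \<in> \<A>"
  shows "H \<in> intersection_poset \<A>"
proof -
  have "H \<noteq> {}"
    using assms line_nonempty by (fastforce simp: line_arrangement_def is_line_def)
  with assms(2) show ?thesis
    unfolding intersection_poset_def by (auto intro!: exI[of _ "{H}"])
qed

context
  fixes \<A> :: "('a::{field,finite}^2) set set"
  assumes \<A>: "line_arrangement \<A>"
begin

lemma card_flat:
  assumes "X \<in> intersection_poset \<A>"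
  shows "card X = CARD('a) ^ affine_dim X"
  using \<A> assms
proof (cases rule: intersection_poset_cases)
  case 1
  then show ?thesis by (simp add: affine_dim_UNIV CARD_vec)
next
  case 2
  then show ?thesis
    using \<A> by (simp add: line_arrangement_def card_line affine_dim_line)
qed (simp add: affine_dim_singleton)

lemma line_proper:
  assumes "H \<in> \<A>"
  shows "card H = CARD('a)" "H \<noteq> UNIV" "H \<noteq> {v}"
proof -
  have ge2: "CARD('a) \<ge> 2"
    by (rule card_field_ge_2)
  show *: "card H = CARD('a)"
    using \<A> assms by (simp add: line_arrangement_def card_line)
  have "CARD('a) < CARD('a) ^ 2"
    using ge2 by (simp add: power2_eq_square)
  then show "H \<noteq> UNIV"
    using * by (auto simp: CARD_vec)
  show "H \<noteq> {v}"
    using * ge2 by auto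
qed

lemma moebius_line:
  assumes "H \<in> \<A>"
  shows "moebius \<A> H = - 1"
proof -
  have "{Y \<in> intersection_poset \<A>. H \<subset> Y} = {UNIV}"
  proof (intro set_eqI iffI)
    fix Y assume "Y \<in> {Y \<in> intersection_poset \<A>. H \<subset> Y}"
    then have Y: "Y \<in> intersection_poset \<A>" "H \<subset> Y" by auto
    from \<A> Y(1) show "Y \<in> {UNIV}"
    proof (cases rule: intersection_poset_cases)
      case 2
      then show ?thesis
        using psubset_card_mono[of Y H] Y(2) line_proper(1) assms by (simp add: line_proper(1))
    next
      case (3 v)
      with Y(2) have "H = {}" by auto
      with line_proper(1)[OF assms] show ?thesis by simp
    qed simp
  qed (use assms line_proper(2) in \<open>auto simp: UNIV_in_intersection_poset\<close>)
  then show ?thesis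
    using line_proper(2)[OF assms] by (subst moebius.simps) (simp add: moebius.simps[of _ UNIV])
qed

text \<open>
  The flats containing \<open>v\<close> are those containing the smallest one among them, so the recursion for the
  Moebius function at that flat evaluates the sum.
\<close>

lemma sum_moebius_containing:
  "(\<Sum>X\<in>{X \<in> intersection_poset \<A>. v \<in> X}. moebius \<A> X) = (if v \<in> \<Union>\<A> then 0 else 1)"
proof -
  define F where "F = \<Inter>{H \<in> \<A>. v \<in> H}"
  have "F \<noteq> {}" by (auto simp: F_def)
  then have F: "F \<in> intersection_poset \<A>"
    unfolding intersection_poset_def F_def
    by (intro DiffI CollectI exI[of _ "{H \<in> \<A>. v \<in> H}"]) auto
  have "{X \<in> intersection_poset \<A>. v \<in> X} = insert F {X \<in> intersection_poset \<A>. F \<subset> X}"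
  proof (intro set_eqI iffI)
    fix X assume "X \<in> {X \<in> intersection_poset \<A>. v \<in> X}"
    then obtain \<B> where "\<B> \<subseteq> \<A>" "X = \<Inter>\<B>" "v \<in> X" and X: "X \<in> intersection_poset \<A>"
      by (auto simp: intersection_poset_def)
    then have "F \<subseteq> X"
      unfolding F_def by auto
    with X show "X \<in> insert F {X \<in> intersection_poset \<A>. F \<subset> X}" by auto
  next
    fix X assume *: "X \<in> insert F {X \<in> intersection_poset \<A>. F \<subset> X}"
    have "v \<in> F" by (simp add: F_def)
    with * F show "X \<in> {X \<in> intersection_poset \<A>. v \<in> X}" by auto
  qed
  then have sum: "(\<Sum>X\<in>{X \<in> intersection_poset \<A>. v \<in> X}. moebius \<A> X) =
      moebius \<A> F + (\<Sum>X\<in>{X \<in> intersection_poset \<A>. F \<subset> X}. moebius \<A> X)"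
    by simp
  have "F = UNIV \<longleftrightarrow> v \<notin> \<Union>\<A>"
    using line_proper(2) by (auto simp: F_def)
  moreover have "{X \<in> intersection_poset \<A>. UNIV \<subset> X} = {}" by auto
  ultimately show ?thesis
    unfolding sum by (subst moebius.simps) auto
qed

lemma poly_characteristic_poly:
  "poly (characteristic_poly \<A>) t = (\<Sum>X\<in>intersection_poset \<A>. moebius \<A> X * t ^ affine_dim X)"
  by (simp add: characteristic_poly_def poly_sum poly_monom)

text \<open>
  A flat \<open>X\<close> has \<open>q\<^bsup>dim X\<^esup>\<close> points, so \<open>\<chi>(q)\<close> counts each point \<open>v\<close> with the total Moebius weight of
  the flats containing \<open>v\<close>.
\<close>

lemma characteristic_poly_at_card:
  "poly (characteristic_poly \<A>) (int CARD('a)) = int (card (- \<Union>\<A>))"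
proof -
  have "poly (characteristic_poly \<A>) (int CARD('a)) =
      (\<Sum>X\<in>intersection_poset \<A>. moebius \<A> X * (\<Sum>v\<in>UNIV. if v \<in> X then 1 else 0))"
    unfolding poly_characteristic_poly
  proof (intro sum.cong refl)
    fix X assume "X \<in> intersection_poset \<A>"
    then have "int CARD('a) ^ affine_dim X = int (card X)"
      by (simp add: card_flat)
    also have "\<dots> = (\<Sum>v\<in>UNIV. if v \<in> X then 1 else 0)"
      by (simp add: sum.If_cases)
    finally show "moebius \<A> X * int CARD('a) ^ affine_dim X =
        moebius \<A> X * (\<Sum>v\<in>UNIV. if v \<in> X then 1 else 0)"
      by simp
  qed
  also have "\<dots> = (\<Sum>v\<in>UNIV. \<Sum>X\<in>intersection_poset \<A>. if v \<in> X then moebius \<A> X else 0)"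
    unfolding sum_distrib_left by (subst sum.swap) (simp add: if_distrib cong: if_cong)
  also have "\<dots> = (\<Sum>v\<in>UNIV. \<Sum>X\<in>{X \<in> intersection_poset \<A>. v \<in> X}. moebius \<A> X)"
    by (simp add: sum.inter_filter)
  also have "\<dots> = (\<Sum>v\<in>UNIV. if v \<in> \<Union>\<A> then 0 else 1)"
    by (simp only: sum_moebius_containing)
  also have "\<dots> = int (card (- \<Union>\<A>))"
    by (simp add: sum.If_cases Compl_eq)
  finally show ?thesis .
qed

text \<open>
  Flats of dimension zero contribute a constant to \<open>\<chi>\<close>, which cancels in this difference. The plane contributes \<open>t\<^sup>2 - (t - 1)\<^sup>2\<close> and each line contributes \<open>- 1\<close>.
\<close>

lemma characteristic_poly_difference:
  "poly (characteristic_poly \<A>) t - poly (characteristic_poly \<A>) (t - 1) = 2 * t - 1 - int (card \<A>)"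
proof -
  let ?g = "\<lambda>X. moebius \<A> X * (t ^ affine_dim X - (t - 1) ^ affine_dim X)"
  have "poly (characteristic_poly \<A>) t - poly (characteristic_poly \<A>) (t - 1) =
      (\<Sum>X\<in>intersection_poset \<A>. ?g X)"
    by (simp add: poly_characteristic_poly sum_subtractf right_diff_distrib)
  also have "\<dots> = (\<Sum>X\<in>insert UNIV \<A>. ?g X)"
  proof (rule sum.mono_neutral_right)
    show "insert UNIV \<A> \<subseteq> intersection_poset \<A>"
      using line_in_intersection_poset[OF \<A>] UNIV_in_intersection_poset by auto
    show "\<forall>X\<in>intersection_poset \<A> - insert UNIV \<A>. ?g X = 0"
    proof
      fix X assume X: "X \<in> intersection_poset \<A> - insert UNIV \<A>"
      then have "X \<in> intersection_poset \<A>" by simp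
      with \<A> show "?g X = 0"
        by (cases rule: intersection_poset_cases) (use X in \<open>auto simp: affine_dim_singleton\<close>)
    qed
  qed simp
  also have "\<dots> = ?g UNIV + (\<Sum>X\<in>\<A>. ?g X)"
    using line_proper(2) by (subst sum.insert) auto
  also have "(\<Sum>X\<in>\<A>. ?g X) = (\<Sum>X\<in>\<A>. - 1)"
    using \<A> by (intro sum.cong) (auto simp: moebius_line line_arrangement_def affine_dim_line)
  also have "?g UNIV = 2 * t - 1"
    by (simp add: moebius.simps[of _ UNIV] affine_dim_UNIV power2_eq_square algebra_simps)
  finally show ?thesis by simp
qed

end


section \<open>The uncovered points are collinear\<close>

lemma ex_line_form_separating:
  fixes s r :: "'a::field^2"
  assumes "s \<noteq> r"
  obtains a b c where "value_at (s $ 1) (s $ 2) 1 (cone_form a b c) = 0"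
    "value_at (r $ 1) (r $ 2) 1 (cone_form a b c) \<noteq> 0"
proof (cases "s $ 1 = r $ 1")
  case True
  with assms have "s $ 2 \<noteq> r $ 2" by (auto simp: vec_eq_iff forall_2)
  then show ?thesis using that[of 0 1 "- s $ 2"] by simp
next
  case False
  then show ?thesis using that[of 1 0 "- s $ 1"] by simp
qed

text \<open>
  A single nonzero value cannot sum to zero.
\<close>

lemma degree_if_one_nonzero:
  fixes g :: "'a::{field,finite} poly3" and r :: "'a^2"
  assumes hom: "homogeneous N g" and r: "value_at (r $ 1) (r $ 2) 1 g \<noteq> 0"
    and zero: "\<And>v :: 'a^2. v \<noteq> r \<Longrightarrow> value_at (v $ 1) (v $ 2) 1 g = 0"
  shows "N \<ge> 2 * (CARD('a) - 1)"
proof (rule ccontr)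
  assume "\<not> N \<ge> 2 * (CARD('a) - 1)"
  then have "(\<Sum>a\<in>UNIV. \<Sum>b\<in>UNIV. value_at a b 1 g) = 0"
    using sum_values_eq_0[OF hom] by simp
  moreover have "value_at a b 1 g =
      (if a = r $ 1 then if b = r $ 2 then value_at (r $ 1) (r $ 2) 1 g else 0 else 0)" for a b
    using zero[of "vector [a, b]"] by (auto simp: vec_eq_iff forall_2 vector_2)
  then have "(\<Sum>a\<in>UNIV. \<Sum>b\<in>UNIV. value_at a b 1 g) = 
      (\<Sum>a\<in>UNIV. \<Sum>b\<in>UNIV.
        if a = r $ 1 then if b = r $ 2 then value_at (r $ 1) (r $ 2) 1 g else 0 else 0)"
    by (intro sum.cong refl)
  then have "(\<Sum>a\<in>UNIV. \<Sum>b\<in>UNIV. value_at a b 1 g) = value_at (r $ 1) (r $ 2) 1 g"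
    by (simp add: if_distrib[of "\<lambda>x. sum x _"] sum.If_cases cong: if_cong)
  ultimately show False using r by simp
qed

text \<open>
  If the line through \<open>p, p' \<in> M\<close> misses \<open>r \<in> M\<close>, then multiplying \<open>f\<close> by its form and by one form for
  each point of \<open>M\<close> other than \<open>p, p', r\<close> gives degree \<open>n + 1 + (|M| - 3) = 2 q - 3\<close> and a single nonzero
  value, at \<open>r\<close>.
\<close>

lemma uncovered_points_collinear:
  fixes \<A> :: "('a::{field,finite}^2) set set"
  assumes \<A>: "line_arrangement \<A>"
    and card: "card (- \<Union>\<A>) + card \<A> = 2 * CARD('a) - 1"
  obtains a b c where "(a, b) \<noteq> (0, 0)" "- \<Union>\<A> \<subseteq> zero_locus a b c"
proof -
  define M where "M = - \<Union>\<A>"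
  have "\<exists>a b c. (a, b) \<noteq> (0, 0) \<and> M \<subseteq> zero_locus a b c"
  proof (cases "\<exists>p\<in>M. \<exists>p'\<in>M. p \<noteq> p'")
    case False
    then obtain p where "M \<subseteq> {p}" by blast
    moreover have "p \<in> zero_locus 1 0 (- p $ 1)"
      by (simp add: zero_locus_def)
    ultimately show ?thesis
      by (intro exI[of _ 1] exI[of _ 0] exI[of _ "- p $ 1"]) auto
  next
    case True
    then obtain p p' where p: "p \<in> M" "p' \<in> M" "p \<noteq> p'"
      by blast
    define a b c where "a = p $ 2 - p' $ 2" and "b = p' $ 1 - p $ 1" and "c = - (a * p $ 1 + b * p $ 2)"
    have ab: "(a, b) \<noteq> (0, 0)"
      using p(3) by (auto simp: a_def b_def vec_eq_iff forall_2)
    have pC: "p \<in> zero_locus a b c" "p' \<in> zero_locus a b c"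
      by (simp_all add: zero_locus_def c_def a_def b_def algebra_simps)
    have "M \<subseteq> zero_locus a b c"
    proof (rule ccontr)
      assume "\<not> M \<subseteq> zero_locus a b c"
      then obtain r where r: "r \<in> M" "r \<notin> zero_locus a b c" by blast
      define M' where "M' = M - {p, p', r}"
      have "\<forall>s\<in>M'. \<exists>l. homogeneous 1 l \<and> value_at (s $ 1) (s $ 2) 1 l = 0 \<and> value_at (r $ 1) (r $ 2) 1 l \<noteq> 0"
      proof
        fix s assume "s \<in> M'"
        then have "s \<noteq> r" by (auto simp: M'_def)
        then show "\<exists>l. homogeneous 1 l \<and> value_at (s $ 1) (s $ 2) 1 l = 0 \<and> value_at (r $ 1) (r $ 2) 1 l \<noteq> 0"
          by (metis ex_line_form_separating homogeneous_cone_form)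
      qed
      then obtain l where l: "\<And>s. s \<in> M' \<Longrightarrow> homogeneous 1 (l s)"
        "\<And>s. s \<in> M' \<Longrightarrow> value_at (s $ 1) (s $ 2) 1 (l s) = 0"
        "\<And>s. s \<in> M' \<Longrightarrow> value_at (r $ 1) (r $ 2) 1 (l s) \<noteq> 0"
        by metis
      define g where "g = defining_poly \<A> * cone_form a b c * prod l M'"
      have hom: "homogeneous (card \<A> + 1 + card M') g"
        unfolding g_def using l(1)
        by (intro homogeneous_mult homogeneous_defining_poly \<A> homogeneous_cone_form homogeneous_prod) auto
      have "value_at (r $ 1) (r $ 2) 1 (defining_poly \<A>) \<noteq> 0"
        using r(1) by (simp only: value_at_defining_poly[OF \<A>]) (simp add: M_def)
      moreover have "value_at (r $ 1) (r $ 2) 1 (cone_form a b c) \<noteq> 0"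
        using r(2) by (simp add: mem_zero_locus del: value_at_cone_form)
      moreover have "value_at (r $ 1) (r $ 2) 1 (prod l M') \<noteq> 0"
        using l(3) by simp
      ultimately have nonzero: "value_at (r $ 1) (r $ 2) 1 g \<noteq> 0"
        unfolding g_def value_at_simps by simp
      have zero: "value_at (v $ 1) (v $ 2) 1 g = 0" if "v \<noteq> r" for v
      proof -
        from that consider "v \<in> \<Union>\<A>" | "v = p \<or> v = p'" | "v \<in> M'"
          by (auto simp: M'_def M_def)
        then show ?thesis
        proof cases
          case 1
          then have "value_at (v $ 1) (v $ 2) 1 (defining_poly \<A>) = 0"
            by (simp only: value_at_defining_poly[OF \<A>])
          then show ?thesis by (simp add: g_def)
        next
          case 2
          then have "value_at (v $ 1) (v $ 2) 1 (cone_form a b c) = 0"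
            using pC by (auto simp only: mem_zero_locus)
          then show ?thesis unfolding g_def value_at_simps by simp
        next
          case 3
          then have "value_at (v $ 1) (v $ 2) 1 (prod l M') = 0"
            using l(2) by auto
          then show ?thesis unfolding g_def value_at_simps by simp
        qed
      qed
      have "card \<A> + 1 + card M' \<ge> 2 * (CARD('a) - 1)"
        by (rule degree_if_one_nonzero[OF hom nonzero zero])
      moreover have "card M = card M' + 3"
      proof -
        have "r \<noteq> p" "r \<noteq> p'"
          using r(2) pC by metis+
        with p(3) have "card {p, p', r} = 3"
          by auto
        moreover have "{p, p', r} \<subseteq> M"
          using p r(1) by simp
        ultimately show ?thesis
          using card_Diff_subset[of "{p, p', r}" M] card_mono[of M "{p, p', r}"]
          by (simp add: M'_def)
      qed
      ultimately show False
        using card card_field_ge_2[where 'a = 'a] by (simp add: M_def)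
    qed
    with ab show ?thesis by blast
  qed
  then show ?thesis
    using that unfolding M_def by blast
qed


section \<open>Freeness\<close>

text \<open>
  If \<open>g = A frob x + B frob y\<close>, then the vector field \<open>(B, - A)\<close> has determinant \<open>g\<close> with the Frobenius
  field. Since \<open>g\<close> is divisible by the form of each line, the two are parallel along that line.
\<close>

lemma tangent_field_of_vanishing_multiple:
  fixes \<A> :: "('a::{field,finite}^2) set set"
  assumes \<A>: "line_arrangement \<A>" and hom: "homogeneous N g"
    and dvd: "defining_poly \<A> dvd g" and van: "\<And>v :: 'a^2. value_at (v $ 1) (v $ 2) 1 g = 0"
  obtains P Q where "tangent_to \<A> P Q" "homogeneous (N - CARD('a)) P" "homogeneous (N - CARD('a)) Q"
    "P * frob Y\<^sub>3 - Q * frob X\<^sub>3 = g"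
proof -
  have "value_at a b 1 g = 0" for a b
    using van[of "vector [a, b]"] by (simp add: vector_2)
  then obtain A B where AB: "homogeneous (N - CARD('a)) A" "homogeneous (N - CARD('a)) B"
      "g = frob X\<^sub>3 * A + frob Y\<^sub>3 * B"
    using vanishing_in_frob_ideal[OF hom] by blast
  have g: "B * frob Y\<^sub>3 - (- A) * frob X\<^sub>3 = g"
    by (simp add: AB(3) algebra_simps)
  have "tangent_to \<A> B (- A)"
    unfolding tangent_to_def
  proof (intro allI impI)
    fix a b c assume ab: "(a, b) \<noteq> (0, 0)" and "zero_locus a b c \<in> \<A>"
    then have "cone_form a b c dvd g"
      using cone_form_dvd_defining_poly[OF \<A>] dvd dvd_trans by blast
    with ab show "cone_form a b c dvd Const a * B + Const b * (- A)"
      unfolding g[symmetric] by (rule tangent_if_det_frob)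
  qed
  then show ?thesis
    using that[OF _ AB(2) homogeneous_minus[OF AB(1)] g] by simp
qed

lemma tangent_to_frob: "tangent_to \<A> (frob X\<^sub>3) (frob Y\<^sub>3)"
  by (simp add: tangent_to_def cone_form_dvd_frob)

text \<open>
  The defining polynomial vanishes on the plane, so it is itself the determinant of some tangent field
  with the Frobenius field.
\<close>

lemma free_if_covering:
  fixes \<A> :: "('a::{field,finite}^2) set set"
  assumes \<A>: "line_arrangement \<A>" and cover: "\<Union>\<A> = UNIV"
  shows "free_arrangement \<A>"
proof -
  have "value_at (v $ 1) (v $ 2) 1 (defining_poly \<A>) = 0" for v :: "'a^2"
    by (simp only: value_at_defining_poly[OF \<A>] cover UNIV_I)
  then obtain P Q where PQ: "tangent_to \<A> P Q" "homogeneous (card \<A> - CARD('a)) P"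
      "homogeneous (card \<A> - CARD('a)) Q" "P * frob Y\<^sub>3 - Q * frob X\<^sub>3 = defining_poly \<A>"
    using tangent_field_of_vanishing_multiple[OF \<A> homogeneous_defining_poly[OF \<A>] dvd_refl] by metis
  show ?thesis
    by (rule saito_criterion[OF \<A> PQ(1) tangent_to_frob PQ(2,3), of "CARD('a)" 1])
      (simp_all add: homogeneous_frob homogeneous_XYZ PQ(4) Const_simps(2) del: One_nat_def)
qed

text \<open>
  The two basis fields come from \<open>f h\<close> and \<open>f \<gamma>\<close>, where \<open>\<gamma>\<close> is the form of the line containing the
  complement and \<open>h\<close> is the product of the forms of the parallel lines with normal vector
  \<open>(a', b')\<close>, chosen transversal to \<open>\<gamma>\<close>, through the points of the complement. Transversality ensures that \<open>\<gamma>\<close> does not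
  divide \<open>h\<close>.
\<close>

lemma free_if_collinear_complement:
  fixes \<A> :: "('a::{field,finite}^2) set set"
  assumes \<A>: "line_arrangement \<A>"
    and card: "card (- \<Union>\<A>) + card \<A> = 2 * CARD('a) - 1"
    and p: "p \<notin> \<Union>\<A>"
    and ab: "(a, b) \<noteq> (0, 0)" and M: "- \<Union>\<A> \<subseteq> zero_locus a b c"
  shows "free_arrangement \<A>"
proof -
  let ?q = "CARD('a)" and ?n = "card \<A>" and ?k = "card (- \<Union>\<A>)"
  let ?f = "defining_poly \<A>" and ?u = "frob X\<^sub>3 :: 'a poly3" and ?v = "frob Y\<^sub>3 :: 'a poly3"
  define \<gamma> where "\<gamma> = cone_form a b c"
  obtain a' b' where ab': "a * b' \<noteq> a' * b"
  proof (cases "a = 0")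
    case True
    with ab that[of 0 1] show ?thesis by simp
  next
    case False
    with that[of 1 0] show ?thesis by simp
  qed
  define l where "l s = cone_form a' b' (- (a' * s $ 1 + b' * s $ 2))" for s :: "'a^2"
  define h where "h = prod l (- \<Union>\<A>)"
  have fM: "value_at (v $ 1) (v $ 2) 1 ?f = 0 \<longleftrightarrow> v \<in> \<Union>\<A>" for v
    by (rule value_at_defining_poly[OF \<A>])
  have prime: "prime_elem \<gamma>"
    unfolding \<gamma>_def by (rule prime_elem_cone_form[OF ab])
  have \<gamma>0: "\<gamma> \<noteq> 0"
    using prime by auto
  have \<gamma>h: "\<not> \<gamma> dvd h"
  proof
    assume "\<gamma> dvd h"
    then obtain s where "\<gamma> dvd l s"
      unfolding h_def using prime_elem_dvd_prod[OF prime finite] by metis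
    then obtain e where "a' = e * a" "b' = e * b"
      unfolding \<gamma>_def l_def using ab by (rule cone_form_dvd_cone_form)
    with ab' show False by simp
  qed
  have "value_at (v $ 1) (v $ 2) 1 (?f * h) = 0" for v :: "'a^2"
  proof (cases "v \<in> \<Union>\<A>")
    case True
    with fM[of v] show ?thesis by simp
  next
    case False
    moreover have "value_at (v $ 1) (v $ 2) 1 (l v) = 0"
      by (simp add: l_def)
    ultimately have "value_at (v $ 1) (v $ 2) 1 h = 0"
      unfolding h_def value_at_prod by (intro prod_zero) auto
    then show ?thesis by simp
  qed
  moreover have "homogeneous (?n + ?k) (?f * h)"
    unfolding h_def l_def
    by (intro homogeneous_mult homogeneous_defining_poly \<A> homogeneous_prod homogeneous_cone_form) simp
  ultimately obtain P Q where PQ: "tangent_to \<A> P Q" "homogeneous (?n + ?k - ?q) P"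
      "homogeneous (?n + ?k - ?q) Q" "P * ?v - Q * ?u = ?f * h"
    using tangent_field_of_vanishing_multiple[OF \<A>, of _ "?f * h"] by (metis dvd_triv_left)
  have "value_at (v $ 1) (v $ 2) 1 (?f * \<gamma>) = 0" for v :: "'a^2"
  proof (cases "v \<in> \<Union>\<A>")
    case True
    with fM[of v] show ?thesis by simp
  next
    case False
    with M have "v \<in> zero_locus a b c" by blast
    then have "value_at (v $ 1) (v $ 2) 1 \<gamma> = 0"
      by (simp only: mem_zero_locus \<gamma>_def)
    then show ?thesis by simp
  qed
  moreover have "homogeneous (?n + 1) (?f * \<gamma>)"
    unfolding \<gamma>_def by (intro homogeneous_mult homogeneous_defining_poly \<A> homogeneous_cone_form)
  ultimately obtain P' Q' where PQ': "tangent_to \<A> P' Q'" "homogeneous (?n + 1 - ?q) P'"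
      "homogeneous (?n + 1 - ?q) Q'" "P' * ?v - Q' * ?u = ?f * \<gamma>"
    using tangent_field_of_vanishing_multiple[OF \<A>, of _ "?f * \<gamma>"] by (metis dvd_triv_left)
  obtain e where e: "P * Q' - Q * P' = ?f * e"
    using defining_poly_dvd_det[OF \<A> PQ(1) PQ'(1)] ..
  \<comment> \<open>The bound \<open>k \<le> q\<close> gives \<open>n + 1 \<ge> q\<close>, so none of the subtractions below is truncated.\<close>
  have "is_line (zero_locus a b c)"
    using ab by (auto simp: is_line_def)
  then have "?k \<le> ?q"
    using card_mono[OF _ M] by (simp add: card_line)
  then have deg: "(?n + ?k - ?q) + (?n + 1 - ?q) = ?n"
    using card card_field_ge_2[where 'a = 'a] by simp
  have "homogeneous ((?n + ?k - ?q) + (?n + 1 - ?q)) (P * Q' - Q * P')"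
    by (intro homogeneous_diff homogeneous_mult PQ PQ')
  then have "homogeneous ?n (?f * e)"
    by (simp only: deg e)
  then obtain e' where e': "e = Const e'"
    using homogeneous_quotient_same_degree homogeneous_defining_poly defining_poly_nonzero \<A> by metis
  have "e' \<noteq> 0"
  proof
    assume "e' = 0"
    then have det: "P * Q' - Q * P' = 0"
      by (simp add: e e' Const_simps)
    \<comment> \<open>Two parallel fields are proportional with the ratio of their determinants with the Frobenius field.\<close>
    have "?f * (h * P' - \<gamma> * P) = (?f * h) * P' - (?f * \<gamma>) * P"
      "?f * (h * Q' - \<gamma> * Q) = (?f * h) * Q' - (?f * \<gamma>) * Q"
      by (simp_all only: algebra_simps)
    moreover have "(P * ?v - Q * ?u) * P' - (P' * ?v - Q' * ?u) * P = ?u * (P * Q' - Q * P')"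
      "(P * ?v - Q * ?u) * Q' - (P' * ?v - Q' * ?u) * Q = ?v * (P * Q' - Q * P')"
      by (simp_all add: algebra_simps)
    ultimately have "?f * (h * P' - \<gamma> * P) = 0" "?f * (h * Q' - \<gamma> * Q) = 0"
      unfolding det PQ(4) PQ'(4) by simp_all
    then have "h * P' = \<gamma> * P" "h * Q' = \<gamma> * Q"
      using defining_poly_nonzero[OF \<A>] by simp_all
    then have "\<gamma> dvd h * P'" "\<gamma> dvd h * Q'"
      by simp_all
    then have "\<gamma> dvd P'" "\<gamma> dvd Q'"
      using \<gamma>h prime by (auto simp: prime_elem_dvd_mult_iff)
    then obtain P'' Q'' where "P' = \<gamma> * P''" "Q' = \<gamma> * Q''"
      by (elim dvdE)
    then have "\<gamma> * ?f = \<gamma> * (P'' * ?v - Q'' * ?u)"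
      using PQ'(4) by (simp add: algebra_simps)
    then have "?f = P'' * ?v - Q'' * ?u"
      using \<gamma>0 by simp
    then have "value_at (p $ 1) (p $ 2) 1 ?f = 0"
      by (simp add: value_at_frob)
    with fM[of p] p show False by simp
  qed
  then show ?thesis
    by (rule saito_criterion[OF \<A> PQ(1) PQ'(1) PQ(2,3) PQ'(2,3) e[unfolded e']])
qed

theorem theorem6p3:
  fixes \<A> :: "('a::{field,finite}^2) set set"
  assumes "line_arrangement \<A>"
    and "poly (characteristic_poly \<A>) (int CARD('a) - 1) = 0"
  shows "free_arrangement \<A>"
proof (cases "\<Union>\<A> = UNIV")
  case True
  with assms(1) show ?thesis by (rule free_if_covering)
next
  case False
  then obtain p where p: "p \<notin> \<Union>\<A>" by blast
  have "int (card (- \<Union>\<A>)) + int (card \<A>) = 2 * int CARD('a) - 1"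
    using characteristic_poly_difference[OF assms(1), of "int CARD('a)"]
      characteristic_poly_at_card[OF assms(1)] assms(2) by simp
  then have card: "card (- \<Union>\<A>) + card \<A> = 2 * CARD('a) - 1"
    by linarith
  obtain a b c where "(a, b) \<noteq> (0, 0)" "- \<Union>\<A> \<subseteq> zero_locus a b c"
    using uncovered_points_collinear[OF assms(1) card] .
  with assms(1) card p show ?thesis
    by (rule free_if_collinear_complement)
qed

end
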